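(* Let $n\ge 1$, $w\in \mathcal{BC}_n$ and $k\geq 0$. Then the $k$-truncated Schubert polynomial $\mathfrak C_w^{[k]}(\mathbf z,\mathbf x)$ of type $C$ equals the sum of monomials over all reduced $c$-signed pipe dreams in $\mathrm{PD}_{\mathcal C_n}^k(w)$: \[ \sum_{D\in\mathrm{PD}_{\mathcal C_n}^k(w)} \mathbf x^{\alpha(D)}\mathbf z^{\beta(D)}=\sum_{\substack{u v=w\\ \ell(u)+\ell(v)=\ell(w) \\ v \in \mathcal S_{n}}}\ \sum_{\substack{\mathbf a \in R(u)\\ \mathbf x^{\alpha} \in \mathscr A_{x}(\mathbf{a})\\\alpha_{k+1}=\alpha_{k+2}=\ldots=0}}\ \sum_{\substack{\mathbf b \in R(v)\\ \mathbf z^{\beta} \in \mathscr A_{z}(\mathbf b)}} 2^{i(\alpha)} \mathbf x^{\alpha} \mathbf z^{\beta}=\mathfrak C_w^{[k]}(\mathbf z,\mathbf x). \]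
   Context: **Groups.** $\mathcal{BC}_n$ is the group of permutations $w$ of $\{\pm1,\dots,\pm n\}$ with $w(-i)=-w(i)$, generated by $s_0=(1\leftrightarrow -1)$ and $s_i=(i\leftrightarrow i+1)$ (also exchanging $-i,-(i+1)$), $1\le i\le n-1$; products are compositions of maps, $(uv)(i)=u(v(i))$. $\mathcal S_n\subset\mathcal{BC}_n$ is the symmetric group generated by $s_1,\dots,s_{n-1}$. $\ell$ is the Coxeter length, $R(w)$ the set of reduced words of $w$; $\mathcal{BC}_\infty=\bigcup_n\mathcal{BC}_n$. **Schubert polynomials of type $C$.** Let $\mathbb Q[\mathbf z,p_1(\mathbf x),p_3(\mathbf x),\dots]$ be the ring of polynomials in $z_1,z_2,\dots$ and the odd power sums $p_k(\mathbf x)=\sum_{i\ge1}x_i^k$ (algebraically independent generators). $\mathcal{BC}_\infty$ acts on it by ring automorphisms: $s_i$ ($i\ge1$) exchanges $z_i$ and $z_{i+1}$ and fixes each $p_k(\mathbf x)$; $s_0$ sends $z_1\mapsto -z_1$, fixes $z_j$ ($j\ge 2$), and sends $p_k(\mathbf x)\mapsto p_k(\mathbf x)+z_1^k$. Put $\partial_if=\frac{f-s_if}{z_i-z_{i+1}}$ ($i\ge1$), $\partial_0f=\frac{f-s_0f}{-2z_1}$. The polynomials $\mathfrak C_w$, $w\in\mathcal{BC}_\infty$, are the unique homogeneous elements ($\deg z_i=1$, $\deg p_k(\mathbf x)=k$) with $\mathfrak C_{\mathrm{id}}=1$ and, for all $i\ge0$, $\partial_i\mathfrak C_w=\mathfrak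 C_{ws_i}$ if $\ell(ws_i)<\ell(w)$ and $\partial_i\mathfrak C_w=0$ otherwise (existence and uniqueness are due to Billey and Haiman). The $k$-truncation is $\mathfrak C_w^{[k]}(\mathbf z,\mathbf x)=\mathfrak C_w(\mathbf z;x_1,\dots,x_k,0,0,\dots)$. **Admissible monomials.** Let $\mathbf a=s_{a_1}\cdots s_{a_l}$ be a reduced word. Its peak set is $P(\mathbf a)=\{i\in\{2,\dots,l-1\}: a_{i-1}<a_i>a_{i+1}\}$. A sequence of positive integers $j_1\ge\dots\ge j_l$ is $x$-admissible for $\mathbf a$ if $j_{i-1}=j_i=j_{i+1}$ implies $i\notin P(\mathbf a)$; $\mathscr A_x(\mathbf a)$ is the set of monomials $\mathbf x^\alpha=x_{j_1}\cdots x_{j_l}$ of such sequences. If $\mathbf a$ is a reduced word of an element of $\mathcal S_n$, a sequence of positive integers $j_1\le\dots\le j_l$ is $z$-admissible for $\mathbf a$ if $j_i\le a_i$ for all $i$ and $j_i=j_{i+1}$ implies $a_i>a_{i+1}$; $\mathscr A_z(\mathbf a)$ is the set of monomials $\mathbf z^\beta=z_{j_1}\cdots z_{j_l}$ of such sequences. $i(\alpha)$ is the number of distinct variables occurring in $\mathbf x^\alpha$ with nonzero exponent. **$c$-signed pipe dreams.** The base $B^k_{\mathcal C_n}$ consists of a staircase block and $k$ $\Gamma$-blocks numbered $1,\dots,k$ from bottom to top, all lying above the staircase block. The staircase block has boxes $(i,j)$, $1\le i\le n-1$, $1\le j\le n-i$ (row $i$ from the top, column $j$ from the left); the box $(i,j)$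 is indexed by $i+j-1$ and has variable $z_i$. Each $\Gamma$-block has a horizontal part, one row of $n$ boxes indexed $0,1,\dots,n-1$ from left to right, and, below that row, a vertical part, one column of $n$ boxes indexed $0,1,\dots,n-1$ from top to bottom; all boxes of the $m$-th $\Gamma$-block have variable $x_m$. A $c$-signed pipe dream $D$ is a filling of the base in which each box of index $0$ in a $\Gamma$-block contains either a single elbow or an elbow with a faucet, and every other box contains either a double elbow or a cross. Significant elements are crosses and elbows with a faucet. A cross in a box of index $i$ contributes the letter $s_i$, an elbow with a faucet the letter $s_0$, elbows without faucets contribute nothing. $\mathrm{word}(D)$ is obtained by reading the letters from top to bottom and in each row from right to left: i.e. the $\Gamma$-blocks $k,k-1,\dots,1$, in each of them first the horizontal part in the order of indices $n-1,\dots,0$, then the vertical part in the order $0,\dots,n-1$; then the staircase rows $1,\dots,n-1$, each from right to left. $\mathbf x^{\alpha(D)}\mathbf z^{\beta(D)}$ is the product of the variables of all boxes containing significant elements. $D$ is reduced of shape $w$ if $\mathrm{word}(D)$ is a reduced word of $w\in\mathcal{BC}_n$; $\mathrm{PD}^k_{\mathcal C_n}(w)$ is the set of reduced $c$-signed pipe dreams with $k$ $\Gamma$-blocks of shape $w$. *)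

theory Defs
  imports Complex_Main "HOL-Library.Poly_Mapping" "HOL-Library.FuncSet"
    "HOL-Combinatorics.Permutations"
begin

section \<open>Signed permutations\<close>

text \<open>Signed permutations act on the integers, fixing \<open>0\<close> and everything of large absolute value,
  so that the groups for different \<open>n\<close> are literally nested.\<close>

definition BC :: "nat \<Rightarrow> (int \<Rightarrow> int) set" where
  "BC n = {w. w permutes ({- int n..int n} - {0}) \<and> (\<forall>i. w (- i) = - w i)}"

definition BC_inf :: "(int \<Rightarrow> int) set" where
  "BC_inf = (\<Union>n. BC n)"

fun sgen :: "nat \<Rightarrow> int \<Rightarrow> int" where
  "sgen 0 = transpose 1 (- 1)"
| "sgen (Suc i) = transpose (int (Suc i)) (int (Suc i) + 1) \<circ>
     transpose (- int (Suc i)) (- (int (Suc i) + 1))"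

text \<open>A word \<open>s\<^bsub>a\<^sub>1\<^esub> \<cdots> s\<^bsub>a\<^sub>l\<^esub>\<close> is represented by the list of its indices.\<close>

definition word_prod :: "nat list \<Rightarrow> int \<Rightarrow> int" where
  "word_prod a = foldr (\<lambda>i u. sgen i \<circ> u) a id"

definition Sym :: "nat \<Rightarrow> (int \<Rightarrow> int) set" where
  "Sym n = {word_prod a | a. set a \<subseteq> {1..<n}}"

definition cox_length :: "(int \<Rightarrow> int) \<Rightarrow> nat" where
  "cox_length w = (LEAST l. \<exists>a. length a = l \<and> word_prod a = w)"

definition reduced_words :: "(int \<Rightarrow> int) \<Rightarrow> nat list set" where
  "reduced_words w = {a. word_prod a = w \<and> length a = cox_length w}"

section \<open>Polynomials\<close>

text \<open>One polynomial ring contains both the variables \<open>x\<^sub>i\<close>, \<open>z\<^sub>i\<close> and independent generators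
  \<open>P m\<close> standing for the power sums \<open>p\<^sub>m(x)\<close>. Only \<open>i \<ge> 1\<close> and odd \<open>m\<close> are meaningful.
  A monomial is a finitely supported exponent function.\<close>

datatype var = X nat | Z nat | P nat

type_synonym polyQ = "(var \<Rightarrow>\<^sub>0 nat) \<Rightarrow>\<^sub>0 rat"

definition Var :: "var \<Rightarrow> polyQ" where
  "Var v = Poly_Mapping.single (Poly_Mapping.single v 1) 1"

text \<open>The ring homomorphism over the rationals that sends each variable \<open>v\<close> to \<open>\<sigma> v\<close>.\<close>

definition poly_subst :: "(var \<Rightarrow> polyQ) \<Rightarrow> polyQ \<Rightarrow> polyQ" where
  "poly_subst \<sigma> f = (\<Sum>m\<in>Poly_Mapping.keys f.
     Poly_Mapping.single 0 (Poly_Mapping.lookup f m) *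
     (\<Prod>v\<in>Poly_Mapping.keys m. \<sigma> v ^ Poly_Mapping.lookup m v))"

definition ring_ZP :: "polyQ set" where
  "ring_ZP = {f. \<forall>m\<in>Poly_Mapping.keys f.
     Poly_Mapping.keys m \<subseteq> {Z i | i. i \<ge> 1} \<union> {P j | j. odd j}}"

fun var_degree :: "var \<Rightarrow> nat" where
  "var_degree (X i) = 1"
| "var_degree (Z i) = 1"
| "var_degree (P j) = j"

definition homogeneous :: "polyQ \<Rightarrow> bool" where
  "homogeneous f \<longleftrightarrow> (\<exists>d. \<forall>m\<in>Poly_Mapping.keys f.
     (\<Sum>v\<in>Poly_Mapping.keys m. var_degree v * Poly_Mapping.lookup m v) = d)"

section \<open>Schubert polynomials of type C\<close>

fun act_var :: "nat \<Rightarrow> var \<Rightarrow> polyQ" where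
  "act_var i (X j) = Var (X j)"
| "act_var i (Z j) =
     (if i = 0 then (if j = 1 then - Var (Z 1) else Var (Z j)) else Var (Z (transpose i (i + 1) j)))"
| "act_var i (P j) = (if i = 0 then Var (P j) + Var (Z 1) ^ j else Var (P j))"

definition act :: "nat \<Rightarrow> polyQ \<Rightarrow> polyQ" where
  "act i = poly_subst (act_var i)"

definition divdiff_denom :: "nat \<Rightarrow> polyQ" where
  "divdiff_denom i = (if i = 0 then - 2 * Var (Z 1) else Var (Z i) - Var (Z (i + 1)))"

text \<open>The exact quotient; it exists and is unique because the difference is divisible by the
  denominator and the polynomial ring is a domain.\<close>

definition divdiff :: "nat \<Rightarrow> polyQ \<Rightarrow> polyQ" where
  "divdiff i f = (THE g. divdiff_denom i * g = f - act i f)"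

definition schubert_C_family :: "((int \<Rightarrow> int) \<Rightarrow> polyQ) \<Rightarrow> bool" where
  "schubert_C_family C \<longleftrightarrow>
     C id = 1 \<and>
     (\<forall>w\<in>BC_inf. C w \<in> ring_ZP \<and> homogeneous (C w) \<and>
        (\<forall>i. divdiff i (C w) =
          (if cox_length (w \<circ> sgen i) < cox_length w then C (w \<circ> sgen i) else 0)))"

fun trunc_var :: "nat \<Rightarrow> var \<Rightarrow> polyQ" where
  "trunc_var k (X j) = Var (X j)"
| "trunc_var k (Z j) = Var (Z j)"
| "trunc_var k (P m) = (\<Sum>i = 1..k. Var (X i) ^ m)"

definition truncation :: "nat \<Rightarrow> polyQ \<Rightarrow> polyQ" where
  "truncation k = poly_subst (trunc_var k)"

section \<open>Admissible monomials\<close>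

text \<open>Lists are indexed from \<open>0\<close>, so these are the usual peak positions shifted by one.\<close>

definition peak_set :: "nat list \<Rightarrow> nat set" where
  "peak_set a = {i. 0 < i \<and> i + 1 < length a \<and> a ! (i - 1) < a ! i \<and> a ! i > a ! (i + 1)}"

definition x_admissible :: "nat list \<Rightarrow> nat list \<Rightarrow> bool" where
  "x_admissible a js \<longleftrightarrow> length js = length a \<and> (\<forall>j\<in>set js. j \<ge> 1) \<and> sorted_wrt (\<ge>) js \<and>
     (\<forall>i. 0 < i \<and> i + 1 < length a \<and> js ! (i - 1) = js ! i \<and> js ! i = js ! (i + 1)
        \<longrightarrow> i \<notin> peak_set a)"

definition z_admissible :: "nat list \<Rightarrow> nat list \<Rightarrow> bool" where
  "z_admissible b js \<longleftrightarrow> length js = length b \<and> (\<forall>j\<in>set js. j \<ge> 1) \<and> sorted_wrt (\<le>) js \<and>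
     (\<forall>i < length b. js ! i \<le> b ! i) \<and>
     (\<forall>i. i + 1 < length b \<and> js ! i = js ! (i + 1) \<longrightarrow> b ! i > b ! (i + 1))"

definition exponent :: "nat list \<Rightarrow> nat \<Rightarrow>\<^sub>0 nat" where
  "exponent js = (\<Sum>j\<leftarrow>js. Poly_Mapping.single j 1)"

text \<open>The monomials are represented by their exponent vectors.\<close>

definition A_x :: "nat list \<Rightarrow> (nat \<Rightarrow>\<^sub>0 nat) set" where
  "A_x a = {exponent js | js. x_admissible a js}"

definition A_z :: "nat list \<Rightarrow> (nat \<Rightarrow>\<^sub>0 nat) set" where
  "A_z b = {exponent js | js. z_admissible b js}"

definition x_monom :: "(nat \<Rightarrow>\<^sub>0 nat) \<Rightarrow> polyQ" where
  "x_monom \<alpha> = (\<Prod>i\<in>Poly_Mapping.keys \<alpha>. Var (X i) ^ Poly_Mapping.lookup \<alpha> i)"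

definition z_monom :: "(nat \<Rightarrow>\<^sub>0 nat) \<Rightarrow> polyQ" where
  "z_monom \<beta> = (\<Prod>i\<in>Poly_Mapping.keys \<beta>. Var (Z i) ^ Poly_Mapping.lookup \<beta> i)"

definition admissible_sum :: "nat \<Rightarrow> nat \<Rightarrow> (int \<Rightarrow> int) \<Rightarrow> polyQ" where
  "admissible_sum n k w =
     (\<Sum>(u, v) \<in> {(u, v). u \<in> BC n \<and> v \<in> Sym n \<and> u \<circ> v = w \<and>
                          cox_length u + cox_length v = cox_length w}.
      \<Sum>(a, \<alpha>) \<in> {(a, \<alpha>). a \<in> reduced_words u \<and> \<alpha> \<in> A_x a \<and>
                          (\<forall>i > k. Poly_Mapping.lookup \<alpha> i = 0)}.
      \<Sum>(b, \<beta>) \<in> {(b, \<beta>). b \<in> reduced_words v \<and> \<beta> \<in> A_z b}.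
        2 ^ card (Poly_Mapping.keys \<alpha>) * x_monom \<alpha> * z_monom \<beta>)"

section \<open>Signed pipe dreams\<close>

text \<open>\<open>Stair i j\<close> is the box in row \<open>i\<close> and column \<open>j\<close> of the staircase block; \<open>Hor m i\<close> and
  \<open>Ver m i\<close> are the boxes of index \<open>i\<close> in the horizontal and vertical part of the
  \<open>m\<close>-th \<open>\<Gamma>\<close>-block.\<close>

datatype box = Stair nat nat | Hor nat nat | Ver nat nat

datatype tile = SingleElbow | FaucetElbow | DoubleElbow | Cross

definition base :: "nat \<Rightarrow> nat \<Rightarrow> box set" where
  "base k n = {Stair i j | i j. 1 \<le> i \<and> i \<le> n - 1 \<and> 1 \<le> j \<and> j \<le> n - i} \<union>
     {Hor m i | m i. 1 \<le> m \<and> m \<le> k \<and> i < n} \<union>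
     {Ver m i | m i. 1 \<le> m \<and> m \<le> k \<and> i < n}"

fun box_index :: "box \<Rightarrow> nat" where
  "box_index (Stair i j) = i + j - 1"
| "box_index (Hor m i) = i"
| "box_index (Ver m i) = i"

fun box_var :: "box \<Rightarrow> var" where
  "box_var (Stair i j) = Z i"
| "box_var (Hor m i) = X m"
| "box_var (Ver m i) = X m"

text \<open>Boxes of the base of index \<open>0\<close> occur only in \<open>\<Gamma>\<close>-blocks.\<close>

definition allowed_tiles :: "box \<Rightarrow> tile set" where
  "allowed_tiles b =
     (if box_index b = 0 then {SingleElbow, FaucetElbow} else {DoubleElbow, Cross})"

definition pipe_dreams :: "nat \<Rightarrow> nat \<Rightarrow> (box \<Rightarrow> tile) set" where
  "pipe_dreams k n = PiE (base k n) allowed_tiles"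

definition significant :: "tile \<Rightarrow> bool" where
  "significant t \<longleftrightarrow> t = Cross \<or> t = FaucetElbow"

definition reading_order :: "nat \<Rightarrow> nat \<Rightarrow> box list" where
  "reading_order k n =
     concat (map (\<lambda>m. map (Hor m) (rev [0..<n]) @ map (Ver m) [0..<n]) (rev [1..<k + 1])) @
     concat (map (\<lambda>i. map (Stair i) (rev [1..<n - i + 1])) [1..<n])"

fun letters :: "tile \<Rightarrow> nat \<Rightarrow> nat list" where
  "letters Cross i = [i]"
| "letters FaucetElbow i = [0]"
| "letters SingleElbow i = []"
| "letters DoubleElbow i = []"

definition pd_word :: "nat \<Rightarrow> nat \<Rightarrow> (box \<Rightarrow> tile) \<Rightarrow> nat list" where
  "pd_word k n D = concat (map (\<lambda>b. letters (D b) (box_index b)) (reading_order k n))"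

definition pd_monom :: "nat \<Rightarrow> nat \<Rightarrow> (box \<Rightarrow> tile) \<Rightarrow> polyQ" where
  "pd_monom k n D = (\<Prod>b\<in>{b \<in> base k n. significant (D b)}. Var (box_var b))"

definition PD :: "nat \<Rightarrow> nat \<Rightarrow> (int \<Rightarrow> int) \<Rightarrow> (box \<Rightarrow> tile) set" where
  "PD k n w = {D \<in> pipe_dreams k n. pd_word k n D \<in> reduced_words w}"

end

theory Submission
  imports Defs
begin

text \<open>In the nil-Coxeter algebra with generators \<open>u\<^sub>i\<close> put \<open>h\<^sub>i(t) = 1 + t u\<^sub>i\<close>,
  \<open>A\<^sub>i(t) = h\<^bsub>n-1\<^esub>(t) \<cdots> h\<^sub>i(t)\<close> and
  \<open>B(t) = h\<^bsub>n-1\<^esub>(t) \<cdots> h\<^sub>0(t) h\<^sub>0(t) \<cdots> h\<^bsub>n-1\<^esub>(t)\<close>.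
  The pipe dream sum for \<open>w\<close> is the coefficient of \<open>u\<^sub>w\<close> in
  \<open>G = B(x\<^sub>k) \<cdots> B(x\<^sub>1) A\<^sub>1(z\<^sub>1) \<cdots> A\<^bsub>n-1\<^esub>(z\<^bsub>n-1\<^esub>)\<close>; splitting \<open>G\<close> into its
  \<open>x\<close>-part and its \<open>z\<close>-part and collecting the letters taken from equal variables gives
  the sum over admissible monomials.

  The Yang--Baxter equation yields
  \<open>A\<^sub>i(a) A\<^bsub>i+1\<^esub>(b) = A\<^sub>i(b) A\<^bsub>i+1\<^esub>(a) h\<^sub>i(a - b)\<close>, and \<open>B(t) A\<^sub>1(- t) = A\<^sub>1(t) h\<^sub>0(2 t)\<close>.
  So exchanging \<open>z\<^sub>i\<close> and \<open>z\<^bsub>i+1\<^esub>\<close>, or negating \<open>z\<^sub>1\<close> while adding it to the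
  \<open>x\<close>-variables, multiplies \<open>G\<close> from the right by a factor \<open>h\<^sub>i\<close>, which is exactly how the
  divided difference equations transform the Schubert polynomials. By induction on the length,
  the difference of the two sides is invariant under these substitutions for every choice of
  \<open>x\<close> and \<open>z\<close>. Being symmetric in infinitely many variables \<open>z\<close>, it does not depend on them;
  then it does not depend on the \<open>x\<close> either, so it equals its value at the origin, which is \<open>0\<close>.\<close>

section \<open>Coxeter combinatorics of signed permutations\<close>

lemma sgen_involution [simp]: "sgen i (sgen i x) = x"
  by (cases i) (auto simp: transpose_def)

lemma sgen_comp_self [simp]: "sgen i \<circ> sgen i = id"
  by (simp add: fun_eq_iff)

lemma comp_sgen_sgen [simp]: "w \<circ> sgen i \<circ> sgen i = w"
  by (simp add: fun_eq_iff)

lemma bij_sgen: "bij (sgen i)"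
  by (rule involuntory_imp_bij) simp

lemma sgen_minus [simp]: "sgen i (- x) = - sgen i x"
  by (cases i) (auto simp: transpose_def)

lemma word_prod_Nil [simp]: "word_prod [] = id"
  and word_prod_Cons [simp]: "word_prod (i # a) = sgen i \<circ> word_prod a"
  by (simp_all add: word_prod_def)

lemma word_prod_append: "word_prod (a @ b) = word_prod a \<circ> word_prod b"
  by (induction a) (simp_all add: comp_assoc)

lemma word_prod_minus [simp]: "word_prod a (- x) = - word_prod a x"
  by (induction a) auto

lemma bij_word_prod: "bij (word_prod a)"
  by (induction a) (simp_all only: word_prod_Nil word_prod_Cons bij_id bij_comp bij_sgen)

lemma word_prod_0 [simp]: "word_prod a 0 = 0"
  using word_prod_minus[of a 0] by simp

lemma id_in_BC: "id \<in> BC n"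
  by (simp add: BC_def permutes_id)

lemma sgen_in_BC: assumes "i < n" shows "sgen i \<in> BC n"
proof (cases i)
  case 0
  then have "sgen i permutes ({- int n..int n} - {0})"
    using assms by (auto intro!: permutes_swap_id)
  then show ?thesis unfolding BC_def by simp
next
  case (Suc j)
  then have "sgen i permutes ({- int n..int n} - {0})"
    using assms unfolding Suc sgen.simps
    by (intro permutes_compose) (auto intro!: permutes_swap_id)
  then show ?thesis unfolding BC_def by simp
qed

lemma comp_in_BC: "u \<in> BC n \<Longrightarrow> v \<in> BC n \<Longrightarrow> u \<circ> v \<in> BC n"
  by (auto simp: BC_def intro: permutes_compose)

lemma word_prod_in_BC: "set a \<subseteq> {..<n} \<Longrightarrow> word_prod a \<in> BC n"
  by (induction a) (auto intro: comp_in_BC sgen_in_BC id_in_BC)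

lemma BC_minus: "w \<in> BC n \<Longrightarrow> w (- x) = - w x"
  by (simp add: BC_def)

lemma BC_fixes: "w \<in> BC n \<Longrightarrow> int n < x \<Longrightarrow> w x = x"
  by (auto simp: BC_def permutes_def)

lemma BC_inj: "w \<in> BC n \<Longrightarrow> w x = w y \<longleftrightarrow> x = y"
  by (auto simp: BC_def dest: permutes_inj injD)

lemma BC_le: assumes "w \<in> BC n" "x \<le> int n" shows "w x \<le> int n"
proof (rule ccontr)
  assume "\<not> w x \<le> int n"
  then have "w (w x) = w x" using BC_fixes[OF assms(1)] by simp
  then have "w x = x" using BC_inj[OF assms(1)] by blast
  then show False using assms(2) \<open>\<not> w x \<le> int n\<close> by simp
qed

lemma BC_zero: "w \<in> BC n \<Longrightarrow> w 0 = 0"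
  by (auto simp: BC_def permutes_def)

section \<open>Descents, exchange and sorting to the identity\<close>

definition is_desc :: "(int \<Rightarrow> int) \<Rightarrow> nat \<Rightarrow> bool" where
  "is_desc w i \<longleftrightarrow> (if i = 0 then w 1 < 0 else w (int i) > w (int i + 1))"

lemma sgen_pos_eq:
  "i > 0 \<Longrightarrow> sgen i x = (if x = int i then int i + 1 else if x = int i + 1 then int i
    else if x = - int i then - int i - 1 else if x = - int i - 1 then - int i else x)"
  by (cases i) (auto simp: transpose_def)

text \<open>A letter with \<open>c > 0\<close> moves a value by at most one, so it reverses two
  values only by exchanging neighbours. Excluding 0 and opposite pairs rules out every reversal by
  s_0, which only changes the signs of 1 and -1.\<close>

lemma sgen_flips_order:
  assumes "x < y" "sgen c x > sgen c y" "x \<noteq> - y" "x \<noteq> 0" "y \<noteq> 0"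
  shows "c > 0 \<and> (x = int c \<and> y = int c + 1 \<or> x = - int c - 1 \<and> y = - int c)"
proof (cases "c = 0")
  case True
  then show ?thesis using assms by (auto simp: transpose_def split: if_splits)
next
  case False
  then have "sgen c t \<le> t \<or> t \<in> {int c, - int c - 1} \<and> sgen c t = t + 1"
    "t \<le> sgen c t \<or> t \<in> {int c + 1, - int c} \<and> sgen c t = t - 1" for t
    by (auto simp: sgen_pos_eq)
  from this(1)[of x] this(2)[of y] show ?thesis using False assms by auto
qed

text \<open>Reading the word from right to left, the order of the images of \<open>i\<close> and \<open>i + 1\<close> is first reversed
  by a letter \<open>c\<close> with \<open>s\<^sub>c v = v s\<^sub>i\<close>, where \<open>v\<close> is the product of the letters after it; this letter
  is the one that gets deleted.\<close>

lemma exchange: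
  assumes "is_desc (word_prod b) i"
  shows "\<exists>b'. length b' < length b \<and> word_prod b' = word_prod b \<circ> sgen i"
  using assms
proof (induction b)
  case Nil
  then show ?case by (simp add: is_desc_def split: if_splits)
next
  case (Cons c b)
  let ?v = "word_prod b"
  show ?case
  proof (cases "is_desc ?v i")
    case True
    then obtain b' where "length b' < length b" "word_prod b' = ?v \<circ> sgen i"
      using Cons.IH by blast
    then show ?thesis by (intro exI[of _ "c # b'"]) (simp add: comp_assoc)
  next
    case False
    have inj: "?v x = ?v y \<longleftrightarrow> x = y" for x y
      using bij_word_prod[of b] by (auto simp: bij_def dest: injD)
    have "sgen c \<circ> ?v = ?v \<circ> sgen i"
    proof (cases i)
      case 0
      have "?v 1 \<noteq> 0" using inj[of 1 0] by simp
      then have pos: "?v 1 > 0" using False 0 by (auto simp: is_desc_def)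
      have neg: "sgen c (?v 1) < 0" using Cons.prems 0 by (auto simp: is_desc_def)
      then have c: "c = 0" "?v 1 = 1"
        using pos by (cases c; auto simp: transpose_def split: if_splits)+
      have m: "?v (- 1) = - 1" using c by simp
      show ?thesis
      proof
        fix x show "(sgen c \<circ> ?v) x = (?v \<circ> sgen i) x"
          using c m inj[of x 1] inj[of x "-1"] 0 by (auto simp: transpose_def)
      qed
    next
      case (Suc j)
      let ?x = "?v (int i)" and ?y = "?v (int i + 1)"
      have le: "?x \<le> ?y" using False Suc by (auto simp: is_desc_def)
      have ne: "?x \<noteq> ?y" "?x \<noteq> - ?y" "?x \<noteq> 0" "?y \<noteq> 0"
        using inj[of "int i" "int i + 1"] inj[of "int i" "- (int i + 1)"] Suc
          inj[of "int i" 0] inj[of "int i + 1" 0]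
          word_prod_minus[of b "int i + 1"] by (auto simp del: word_prod_minus)
      have gt: "sgen c ?x > sgen c ?y" using Cons.prems Suc by (auto simp: is_desc_def)
      have c: "c > 0 \<and> (?x = int c \<and> ?y = int c + 1 \<or> ?x = - int c - 1 \<and> ?y = - int c)"
        using le ne gt by (intro sgen_flips_order) auto
      have "- int i - 1 = - (int i + 1)" "- 1 - int i = - (int i + 1)" by simp_all
      then have m: "?v (- int i) = - ?x" "?v (- int i - 1) = - ?y" "?v (- 1 - int i) = - ?y"
        by (simp_all only: word_prod_minus)
      obtain c' where c': "c = Suc c'" using c by (cases c) auto
      show ?thesis
      proof
        fix t
        consider "t \<in> {int i, int i + 1, - int i, - int i - 1}"
          | "t \<notin> {int i, int i + 1, - int i, - int i - 1}" by blast
        then show "(sgen c \<circ> ?v) t = (?v \<circ> sgen i) t"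
        proof cases
          case 1
          have "sgen i (int i) = int i + 1" "sgen i (int i + 1) = int i"
            "sgen i (- int i) = - int i - 1" "sgen i (- int i - 1) = - int i"
            "sgen c (int c) = int c + 1" "sgen c (int c + 1) = int c" "sgen c (1 + int c) = int c"
            "sgen c (- int c) = - int c - 1" "sgen c (- int c - 1) = - int c"
            unfolding c' Suc by (simp_all add: transpose_def)
          with 1 c m show ?thesis by auto
        next
          case 2
          then have "sgen i t = t" unfolding Suc by (auto simp: transpose_def)
          moreover have "?v t \<notin> {?x, ?y, - ?x, - ?y}"
            using 2 unfolding m(1,2)[symmetric] insert_iff empty_iff inj by simp
          then have "?v t \<notin> {int c, int c + 1, - int c, - int c - 1}" using c by auto
          then have "sgen c (?v t) = ?v t" unfolding c' by (auto simp: transpose_def)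
          ultimately show ?thesis by simp
        qed
      qed
    qed
    then have "word_prod (c # b) \<circ> sgen i = ?v" by (simp only: word_prod_Cons comp_sgen_sgen)
    then show ?thesis by (metis length_Cons lessI)
  qed
qed

text \<open>The sum of \<open>j * w j\<close> is the bounded measure for which sorting by descents terminates.\<close>

lemma no_desc_imp_id:
  assumes w: "w \<in> BC n" and nd: "\<And>i. i < n \<Longrightarrow> \<not> is_desc w i"
  shows "w = id"
proof -
  have asc: "w (int i) < w (int i + 1)" if "i < n" for i
  proof (cases "i = 0")
    case True
    have "w 1 \<noteq> 0" using BC_inj[OF w, of 1 0] BC_zero[OF w] by simp
    then show ?thesis using nd[OF that] BC_zero[OF w] True by (auto simp: is_desc_def)
  next
    case False
    then show ?thesis using nd[OF that] BC_inj[OF w, of "int i" "int i + 1"]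
      by (auto simp: is_desc_def)
  qed
  \<comment> \<open>Strict increase from \<open>w 0 = 0\<close> pushes each value up to its
    position; strict increase towards the bound n at position n, followed downwards, pushes it down
    to its position.\<close>
  have lo: "int i \<le> w (int i)" if "i \<le> n" for i
    using that
  proof (induction i)
    case 0 then show ?case using BC_zero[OF w] by simp
  next
    case (Suc i) then show ?case using asc[of i] by (simp add: add.commute)
  qed
  have hi: "w (int (n - j)) \<le> int (n - j)" if "j \<le> n" for j
    using that
  proof (induction j)
    case 0 then show ?case using BC_le[OF w] by simp
  next
    case (Suc j) then show ?case using asc[of "n - Suc j"]
      by (simp add: of_nat_diff)
  qed
  have nat: "w (int i) = int i" for i
    using lo[of i] hi[of "n - i"] BC_fixes[OF w, of "int i"] by (cases "i \<le> n") auto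
  have "w x = x" for x
    using nat[of "nat x"] nat[of "nat (- x)"] BC_minus[OF w, of "- x"] by (cases "x \<ge> 0") auto
  then show ?thesis by auto
qed

lemma comp_sgen_values:
  assumes "w \<in> BC n"
  shows "(w \<circ> sgen 0) (int j) = (if j = 1 then - w 1 else w (int j))"
    and "i > 0 \<Longrightarrow> (w \<circ> sgen i) (int j) =
      (if j = i then w (int i + 1) else if j = i + 1 then w (int i) else w (int j))"
  subgoal using BC_minus[OF assms, of 1] by (auto simp: transpose_def)
  subgoal by (cases i) (auto simp: transpose_def)
  done

text \<open>Only the terms at \<open>i\<close> and \<open>i + 1\<close> change, and the sum grows by
  \<open>w i - w (i + 1)\<close>; for \<open>i = 0\<close> it grows by \<open>- 2 * w 1\<close>.
  Both are positive at a descent.\<close>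

lemma weight_increases:
  assumes w: "w \<in> BC n" and i: "i < n" and d: "is_desc w i"
  shows "(\<Sum>j=1..n. int j * w (int j)) < (\<Sum>j=1..n. int j * (w \<circ> sgen i) (int j))"
proof (cases "i = 0")
  case True
  have "(\<Sum>j=1..n. int j * w (int j)) = w 1 + (\<Sum>j\<in>{1..n} - {1}. int j * w (int j))"
    using i by (subst sum.remove[of _ 1]) auto
  also have "\<dots> < - w 1 + (\<Sum>j\<in>{1..n} - {1}. int j * w (int j))"
    using d True by (simp add: is_desc_def)
  also have "(\<Sum>j\<in>{1..n} - {1}. int j * w (int j)) =
      (\<Sum>j\<in>{1..n} - {1}. int j * (w \<circ> sgen i) (int j))"
    by (intro sum.cong) (use comp_sgen_values(1)[OF w] True in auto)
  also have "- w 1 + \<dots> = (\<Sum>j=1..n. int j * (w \<circ> sgen i) (int j))"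
    using i comp_sgen_values(1)[OF w, of 1] True by (subst (2) sum.remove[of _ 1]) auto
  finally show ?thesis .
next
  case False
  have split: "(\<Sum>j=1..n. f j) = f i + f (i + 1) + (\<Sum>j\<in>{1..n} - {i, i + 1}. f j)"
    for f :: "nat \<Rightarrow> int"
  proof -
    have "(\<Sum>j=1..n. f j) = (\<Sum>j\<in>{i, i + 1}. f j) + (\<Sum>j\<in>{1..n} - {i, i + 1}. f j)"
      using False i by (subst sum.subset_diff[of "{i, i + 1}"]) auto
    then show ?thesis by simp
  qed
  have "(\<Sum>j\<in>{1..n} - {i, i + 1}. int j * w (int j)) =
      (\<Sum>j\<in>{1..n} - {i, i + 1}. int j * (w \<circ> sgen i) (int j))"
    by (intro sum.cong) (use comp_sgen_values(2)[OF w] False in auto)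
  moreover have "int i * w (int i) + int (i + 1) * w (int (i + 1)) <
      int i * (w \<circ> sgen i) (int i) + int (i + 1) * (w \<circ> sgen i) (int (i + 1))"
    using d False comp_sgen_values(2)[OF w, of i i] comp_sgen_values(2)[OF w, of i "i + 1"]
    by (auto simp: is_desc_def algebra_simps simp del: o_apply)
  ultimately show ?thesis unfolding split by linarith
qed

lemma weight_bound:
  assumes "w \<in> BC n" shows "(\<Sum>j=1..n. int j * w (int j)) \<le> int n * (int n * int n)"
proof -
  have "(\<Sum>j=1..n. int j * w (int j)) \<le> (\<Sum>j=1..n. int n * int n)"
  proof (rule sum_mono)
    fix j assume j: "j \<in> {1..n}"
    have "int j * w (int j) \<le> int j * int n"
      using BC_le[OF assms, of "int j"] j by (intro mult_left_mono) auto
    also have "\<dots> \<le> int n * int n" using j by (intro mult_right_mono) auto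
    finally show "int j * w (int j) \<le> int n * int n" .
  qed
  then show ?thesis by simp
qed

text \<open>Sorting: right multiplication at descents raises the bounded weight, hence ends at an
  element without descents, the identity. The letters used, in reverse order, spell
  \<open>w\<close>.\<close>

lemma BC_words: "w \<in> BC n \<Longrightarrow> \<exists>a. set a \<subseteq> {..<n} \<and> word_prod a = w"
proof (induction "nat (int n * (int n * int n) - (\<Sum>j=1..n. int j * w (int j)))"
    arbitrary: w rule: less_induct)
  case less
  show ?case
  proof (cases "\<exists>i<n. is_desc w i")
    case True
    then obtain i where i: "i < n" "is_desc w i" by blast
    have w': "w \<circ> sgen i \<in> BC n" using less.prems i by (intro comp_in_BC sgen_in_BC)
    have "\<exists>a. set a \<subseteq> {..<n} \<and> word_prod a = w \<circ> sgen i"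
      by (rule less.hyps[OF _ w'])
        (use weight_increases[OF less.prems i] weight_bound[OF w'] in linarith)
    then obtain a where "set a \<subseteq> {..<n}" "word_prod a = w \<circ> sgen i" by blast
    then show ?thesis using i by (intro exI[of _ "a @ [i]"]) (simp add: word_prod_append)
  next
    case False
    then show ?thesis using no_desc_imp_id[OF less.prems] by (intro exI[of _ "[]"]) auto
  qed
qed

lemma BC_inf_iff_word: "w \<in> BC_inf \<longleftrightarrow> (\<exists>a. word_prod a = w)"
proof
  assume "\<exists>a. word_prod a = w"
  then obtain a where a: "word_prod a = w" by blast
  have "w \<in> BC (Suc (Max (insert 0 (set a))))"
    unfolding a[symmetric] by (rule word_prod_in_BC) (auto simp: less_Suc_eq_le)
  then show "w \<in> BC_inf" by (auto simp: BC_inf_def)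
qed (use BC_words in \<open>force simp: BC_inf_def\<close>)

lemma BC_subset_BC_inf: "w \<in> BC n \<Longrightarrow> w \<in> BC_inf"
  by (auto simp: BC_inf_def)

lemma BC_inf_comp_sgen [simp]: "w \<circ> sgen i \<in> BC_inf \<longleftrightarrow> w \<in> BC_inf"
proof -
  have "w \<circ> sgen i \<in> BC_inf" if "w \<in> BC_inf" for w
  proof -
    from that obtain a where "word_prod a = w" by (auto simp: BC_inf_iff_word)
    then have "word_prod (a @ [i]) = w \<circ> sgen i" by (simp add: word_prod_append)
    then show ?thesis unfolding BC_inf_iff_word by blast
  qed
  from this[of w] this[of "w \<circ> sgen i"] show ?thesis by auto
qed

section \<open>Coxeter length and reduced words\<close>

lemma cox_length_le: "cox_length (word_prod a) \<le> length a"
  unfolding cox_length_def by (rule Least_le) blast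

text \<open>Membership in \<open>BC_inf\<close> provides a word, so the minimum under
  \<open>LEAST\<close> in \<open>cox_length\<close> is attained.\<close>

lemma reduced_words_nonempty: "w \<in> BC_inf \<Longrightarrow> \<exists>a. a \<in> reduced_words w"
  unfolding reduced_words_def cox_length_def BC_inf_iff_word mem_Collect_eq
  by (rule LeastI2_ex[where P = "\<lambda>l. \<exists>a. length a = l \<and> word_prod a = w"]) auto

lemma cox_length_comp_sgen_le: "w \<in> BC_inf \<Longrightarrow> cox_length (w \<circ> sgen i) \<le> cox_length w + 1"
proof -
  assume "w \<in> BC_inf"
  then obtain a where "a \<in> reduced_words w" using reduced_words_nonempty by blast
  then show ?thesis using cox_length_le[of "a @ [i]"]
    by (auto simp: reduced_words_def word_prod_append)
qed

lemma cox_length_comp_sgen_ge: "w \<in> BC_inf \<Longrightarrow> cox_length w \<le> cox_length (w \<circ> sgen i) + 1"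
  using cox_length_comp_sgen_le[of "w \<circ> sgen i" i] by simp

lemma cox_length_comp_le:
  assumes "u \<in> BC_inf" "v \<in> BC_inf"
  shows "cox_length (u \<circ> v) \<le> cox_length u + cox_length v"
proof -
  from assms obtain a b where "a \<in> reduced_words u" "b \<in> reduced_words v"
    using reduced_words_nonempty by blast
  then show ?thesis using cox_length_le[of "a @ b"]
    by (auto simp: reduced_words_def word_prod_append)
qed

lemma cox_length_id [simp]: "cox_length id = 0"
  using cox_length_le[of "[]"] by simp

text \<open>Lengths of \<open>w\<close> and of w s_i differ by at most one, so a drop is a drop by
  exactly one. This recursion on the last letter is the one that \<open>nil_op\<close>
  follows.\<close>

lemma reduced_words_snoc:
  "a @ [i] \<in> reduced_words w \<longleftrightarrow>
    w \<in> BC_inf \<and> cox_length (w \<circ> sgen i) < cox_length w \<and> a \<in> reduced_words (w \<circ> sgen i)"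
proof
  assume a: "a @ [i] \<in> reduced_words w"
  then have "word_prod a \<circ> sgen i = w" by (simp add: reduced_words_def word_prod_append)
  then have *: "word_prod a = w \<circ> sgen i" by (metis comp_sgen_sgen)
  moreover have "w \<in> BC_inf" "length a + 1 = cox_length w"
    using a by (auto simp: reduced_words_def BC_inf_iff_word)
  ultimately show "w \<in> BC_inf \<and> cox_length (w \<circ> sgen i) < cox_length w \<and>
      a \<in> reduced_words (w \<circ> sgen i)"
    using cox_length_le[of a] cox_length_comp_sgen_ge[of w i] by (auto simp: reduced_words_def)
next
  assume "w \<in> BC_inf \<and> cox_length (w \<circ> sgen i) < cox_length w \<and>
      a \<in> reduced_words (w \<circ> sgen i)"
  then show "a @ [i] \<in> reduced_words w"
    using cox_length_comp_sgen_ge[of w i] by (auto simp: reduced_words_def word_prod_append)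
qed

text \<open>With u and v the products of the two parts, length(uv) is at most length(u) + length(v),
  which is at most the number of letters; for a reduced word the two ends agree, so equality holds
  throughout.\<close>

lemma reduced_words_append:
  assumes "a @ b \<in> reduced_words w"
  shows "a \<in> reduced_words (word_prod a)" "b \<in> reduced_words (word_prod b)"
    "cox_length (word_prod a) + cox_length (word_prod b) = cox_length w"
proof -
  have "word_prod a \<circ> word_prod b = w" "length a + length b = cox_length w"
    using assms by (auto simp: reduced_words_def word_prod_append)
  moreover have "cox_length (word_prod a \<circ> word_prod b) \<le>
      cox_length (word_prod a) + cox_length (word_prod b)"
    by (rule cox_length_comp_le) (auto simp: BC_inf_iff_word)
  ultimately have "length a = cox_length (word_prod a) \<and> length b = cox_length (word_prod b)"
    using cox_length_le[of a] cox_length_le[of b] by auto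
  then show "a \<in> reduced_words (word_prod a)" "b \<in> reduced_words (word_prod b)"
    "cox_length (word_prod a) + cox_length (word_prod b) = cox_length w"
    using \<open>length a + length b = cox_length w\<close> by (auto simp: reduced_words_def)
qed

text \<open>A repeated letter would be a reduced factor s_i s_i, but its product is the identity, of
  length 0. Hence consecutive letters are comparable strictly, as the count of peaks
  requires.\<close>

lemma reduced_words_adjacent:
  assumes "a \<in> reduced_words w" "i + 1 < length a"
  shows "a ! i \<noteq> a ! (i + 1)"
proof
  assume eq: "a ! i = a ! (i + 1)"
  have a: "a = take i a @ [a ! i, a ! i] @ drop (i + 2) a"
    using assms(2) eq Cons_nth_drop_Suc[of i a] Cons_nth_drop_Suc[of "Suc i" a]
      append_take_drop_id[of i a] by simp
  have "[a ! i, a ! i] @ drop (i + 2) a \<in> reduced_words (word_prod ([a ! i, a ! i] @ drop (i + 2) a))"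
    using reduced_words_append(2) assms(1) a by metis
  then have "[a ! i, a ! i] \<in> reduced_words (word_prod [a ! i, a ! i])"
    using reduced_words_append(1) by blast
  then show False by (simp add: reduced_words_def)
qed

text \<open>If \<open>i\<close> were no descent of \<open>w\<close>, it would be one of the product
  of \<open>a\<close>; by \<open>exchange\<close>, \<open>w\<close> would then have a word shorter
  than \<open>a\<close>.\<close>

lemma reduced_words_last_desc:
  assumes "a @ [i] \<in> reduced_words w" shows "is_desc w i"
proof (rule ccontr)
  assume nd: "\<not> is_desc w i"
  have w: "word_prod a \<circ> sgen i = w" and len: "cox_length w = Suc (length a)"
    using assms by (auto simp: reduced_words_def word_prod_append)
  have a: "word_prod a = w \<circ> sgen i" by (simp add: w[symmetric])
  have bc: "w \<in> BC_inf" using assms by (auto simp: reduced_words_def BC_inf_iff_word)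
  then obtain n where wn: "w \<in> BC n" by (auto simp: BC_inf_def)
  have "is_desc (word_prod a) i"
  proof (cases "i = 0")
    case True
    have "w 1 \<noteq> 0" using BC_inj[OF wn, of 1 0] BC_zero[OF wn] by simp
    then show ?thesis using nd True comp_sgen_values(1)[OF wn, of 1] unfolding a
      by (simp add: is_desc_def)
  next
    case False
    have "w (int i) \<noteq> w (int i + 1)" using BC_inj[OF wn] by simp
    then show ?thesis
      using nd False comp_sgen_values(2)[OF wn, of i i] comp_sgen_values(2)[OF wn, of i "i + 1"]
      unfolding a by (auto simp: is_desc_def add.commute)
  qed
  from exchange[OF this] obtain b where "length b < length a" "word_prod b = w"
    using w by auto
  then show False using len cox_length_le[of b] by auto
qed

text \<open>The last letter is a descent, whereas \<open>w\<close> fixes everything beyond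
  \<open>n\<close> and so has no descent from \<open>n\<close> on. Removing this letter stays inside
  \<open>BC n\<close>.\<close>

lemma reduced_words_BC_letters:
  "a \<in> reduced_words w \<Longrightarrow> w \<in> BC n \<Longrightarrow> set a \<subseteq> {..<n}"
proof (induction a arbitrary: w rule: rev_induct)
  case (snoc i a)
  have "i < n"
  proof (rule ccontr)
    assume i: "\<not> i < n"
    have "w (int i + 1) = int i + 1" using BC_fixes[OF snoc.prems(2)] i by simp
    moreover have "w (int i) \<le> int i"
      using BC_le[OF snoc.prems(2), of "int i"] BC_fixes[OF snoc.prems(2), of "int i"] i
      by (cases "i = n") auto
    ultimately show False using reduced_words_last_desc[OF snoc.prems(1)]
      by (auto simp: is_desc_def split: if_splits)
  qed
  moreover have "w \<circ> sgen i \<in> BC n" using \<open>i < n\<close> snoc.prems by (intro comp_in_BC sgen_in_BC)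
  ultimately show ?case using snoc reduced_words_snoc by auto
qed simp

lemma word_prod_pos:
  "set a \<subseteq> {1..} \<Longrightarrow> x > 0 \<Longrightarrow> word_prod a x > 0"
proof (induction a)
  case (Cons i a)
  then have "word_prod a x > 0" by simp
  then show ?case using Cons.prems by (cases i) (auto simp: transpose_def)
qed simp

lemma Sym_comp_sgen: "w \<in> Sym n \<Longrightarrow> 0 < i \<Longrightarrow> i < n \<Longrightarrow> w \<circ> sgen i \<in> Sym n"
proof -
  assume "w \<in> Sym n" "0 < i" "i < n"
  then obtain a where "set a \<subseteq> {1..<n}" "w = word_prod a" by (auto simp: Sym_def)
  with \<open>0 < i\<close> \<open>i < n\<close> have "set (a @ [i]) \<subseteq> {1..<n}" "w \<circ> sgen i = word_prod (a @ [i])"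
    by (auto simp: word_prod_append)
  then show ?thesis unfolding Sym_def by blast
qed

lemma Sym_subset_BC: "w \<in> Sym n \<Longrightarrow> w \<in> BC n"
  by (auto simp: Sym_def intro!: word_prod_in_BC)

text \<open>Products of s_1, s_2, ... keep 1 positive, so 0 is never a descent and s_0 never a last
  letter; removing the last letter stays in \<open>Sym n\<close>.\<close>

lemma reduced_words_Sym_letters:
  "a \<in> reduced_words w \<Longrightarrow> w \<in> Sym n \<Longrightarrow> set a \<subseteq> {1..<n}"
proof (induction a arbitrary: w rule: rev_induct)
  case (snoc i a)
  have "i < n" using reduced_words_BC_letters[OF snoc.prems(1) Sym_subset_BC[OF snoc.prems(2)]]
    by simp
  moreover have "i > 0"
  proof (rule ccontr)
    assume "\<not> i > 0"
    then have "w 1 < 0" using reduced_words_last_desc[OF snoc.prems(1)] by (simp add: is_desc_def)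
    moreover obtain b where "set b \<subseteq> {1..<n}" "w = word_prod b" 
      using snoc.prems(2) by (auto simp: Sym_def)
    then have "w 1 > 0" using word_prod_pos[of b 1] by force
    ultimately show False by simp
  qed
  moreover have "set a \<subseteq> {1..<n}"
    using snoc.IH[of "w \<circ> sgen i"] snoc.prems Sym_comp_sgen[of w n i] \<open>i > 0\<close> \<open>i < n\<close>
    unfolding reduced_words_snoc by blast
  ultimately show ?case by simp
qed simp

lemma finite_reduced_words: assumes "w \<in> BC n" shows "finite (reduced_words w)"
proof (rule finite_subset)
  show "reduced_words w \<subseteq> {a. set a \<subseteq> {..<n} \<and> length a = cox_length w}"
    using reduced_words_BC_letters[OF _ assms] by (auto simp: reduced_words_def)
qed (simp add: finite_lists_length_eq)

lemma finite_BC: "finite (BC n)"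
  by (rule finite_subset[OF _ finite_permutations[of "{- int n..int n} - {0}"]])
    (auto simp: BC_def)

section \<open>The nil-Coxeter algebra\<close>

declare sgen.simps(2) [simp del]

text \<open>A function \<open>g\<close> on signed permutations stands for the element \<open>\<Sum>w. g w u\<^sub>w\<close> of the
  nil-Coxeter algebra, on which \<open>nil_op i\<close> and \<open>hfac i t\<close> act as right multiplication by
  \<open>u\<^sub>i\<close> and by \<open>1 + t u\<^sub>i\<close>.\<close>

definition nil_op :: "nat \<Rightarrow> ((int \<Rightarrow> int) \<Rightarrow> 'a::comm_ring_1) \<Rightarrow> (int \<Rightarrow> int) \<Rightarrow> 'a" where
  "nil_op i g w = (if w \<in> BC_inf \<and> cox_length (w \<circ> sgen i) < cox_length w
     then g (w \<circ> sgen i) else 0)"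

definition hfac :: "nat \<Rightarrow> 'a \<Rightarrow> ((int \<Rightarrow> int) \<Rightarrow> 'a::comm_ring_1) \<Rightarrow> (int \<Rightarrow> int) \<Rightarrow> 'a" where
  "hfac i t g w = g w + t * nil_op i g w"

text \<open>The list is a product read from left to right: since each \<open>hfac\<close> multiplies
  from the right, the head acts first.\<close>

fun hprod :: "(nat \<times> 'a) list \<Rightarrow> ((int \<Rightarrow> int) \<Rightarrow> 'a::comm_ring_1) \<Rightarrow> (int \<Rightarrow> int) \<Rightarrow> 'a" where
  "hprod [] g = g"
| "hprod ((i, t) # L) g = hprod L (hfac i t g)"

lemma hprod_append: "hprod (L @ M) = hprod M \<circ> hprod L"
proof
  show "hprod (L @ M) g = (hprod M \<circ> hprod L) g" for g :: "(int \<Rightarrow> int) \<Rightarrow> 'a"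
    by (induction L g rule: hprod.induct) auto
qed

text \<open>Allows a relation to be applied to consecutive factors inside a longer product.\<close>

lemma hprod_cong: "hprod K = hprod K' \<Longrightarrow> hprod (L @ K @ M) = hprod (L @ K' @ M)"
  by (simp add: hprod_append)

section \<open>Coxeter relations and their nil-Coxeter form\<close>

lemma sgen_commute:
  assumes "i + 2 \<le> j" shows "sgen i \<circ> sgen j = sgen j \<circ> sgen i"
proof
  fix x show "(sgen i \<circ> sgen j) x = (sgen j \<circ> sgen i) x"
  proof (cases "i = 0")
    case True
    have "sgen 0 y = (if y = 1 then - 1 else if y = - 1 then 1 else y)" for y
      by (simp add: transpose_def)
    then show ?thesis using assms True by (simp add: sgen_pos_eq)
  next
    case False
    then show ?thesis using assms by (simp add: sgen_pos_eq)
  qed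
qed

lemma sgen_braid:
  assumes "i > 0"
  shows "sgen i \<circ> sgen (Suc i) \<circ> sgen i = sgen (Suc i) \<circ> sgen i \<circ> sgen (Suc i)"
proof
  fix x show "(sgen i \<circ> sgen (Suc i) \<circ> sgen i) x = (sgen (Suc i) \<circ> sgen i \<circ> sgen (Suc i)) x"
  proof (cases "\<exists>y\<in>{int i, int i + 1, int i + 2}. x = y \<or> x = - y")
    case True
    have "sgen i (int i) = int i + 1" "sgen i (int i + 1) = int i"
      "sgen i (int i + 2) = int i + 2" "sgen (Suc i) (int i) = int i"
      "sgen (Suc i) (int i + 1) = int i + 2" "sgen (Suc i) (int i + 2) = int i + 1"
      using assms by (simp_all add: sgen_pos_eq)
    then have *: "(sgen i \<circ> sgen (Suc i) \<circ> sgen i) y = (sgen (Suc i) \<circ> sgen i \<circ> sgen (Suc i)) y"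
      if "y \<in> {int i, int i + 1, int i + 2}" for y
      using that by auto
    from True obtain y where "y \<in> {int i, int i + 1, int i + 2}" "x = y \<or> x = - y" by blast
    then show ?thesis using *[of y] by (elim disjE) simp_all
  next
    case False
    then have "x \<noteq> int i" "x \<noteq> int i + 1" "x \<noteq> int i + 2"
      "x \<noteq> - int i" "x \<noteq> - int i - 1" "x \<noteq> - int i - 2" by auto
    moreover have "sgen i x = x" if "x \<notin> {int i, int i + 1, - int i, - int i - 1}" "i > 0" for i
      using that by (auto simp: sgen_pos_eq)
    ultimately have "sgen i x = x" "sgen (Suc i) x = x" using assms by simp_all
    then show ?thesis by simp
  qed
qed

text \<open>One letter changes the length by at most one, so both steps descend iff the total drop
  is two. The composite then depends only on the product of the two letters, and group relations
  carry over.\<close>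

lemma nil_op_2:
  "nil_op i (nil_op j g) w = (if w \<in> BC_inf \<and> cox_length (w \<circ> sgen i \<circ> sgen j) + 2 = cox_length w
     then g (w \<circ> sgen i \<circ> sgen j) else 0)"
proof (cases "w \<in> BC_inf")
  case True
  have "cox_length w \<le> cox_length (w \<circ> sgen i) + 1"
    "cox_length (w \<circ> sgen i) \<le> cox_length (w \<circ> sgen i \<circ> sgen j) + 1"
    using True by (metis True BC_inf_comp_sgen cox_length_comp_sgen_ge)+
  then show ?thesis using True by (simp add: nil_op_def)
qed (simp add: nil_op_def)

lemma nil_op_3:
  "nil_op i (nil_op j (nil_op k g)) w =
    (if w \<in> BC_inf \<and> cox_length (w \<circ> sgen i \<circ> sgen j \<circ> sgen k) + 3 = cox_length w
     then g (w \<circ> sgen i \<circ> sgen j \<circ> sgen k) else 0)"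
proof (cases "w \<in> BC_inf")
  case True
  have "cox_length w \<le> cox_length (w \<circ> sgen i) + 1"
    "cox_length (w \<circ> sgen i) \<le> cox_length (w \<circ> sgen i \<circ> sgen j) + 1"
    "cox_length (w \<circ> sgen i \<circ> sgen j) \<le> cox_length (w \<circ> sgen i \<circ> sgen j \<circ> sgen k) + 1"
    using True by (metis True BC_inf_comp_sgen cox_length_comp_sgen_ge)+
  then show ?thesis using True unfolding nil_op_2 unfolding nil_op_def by auto
qed (simp add: nil_op_def)

lemma nil_op_square: "nil_op i (nil_op i g) = (\<lambda>w. 0)"
  unfolding nil_op_2 by (simp add: fun_eq_iff)

lemma nil_op_commute:
  assumes "i + 2 \<le> j" shows "nil_op i (nil_op j g) = nil_op j (nil_op i g)"
  unfolding nil_op_2 comp_assoc sgen_commute[OF assms] by simp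

lemma nil_op_braid:
  assumes "i > 0"
  shows "nil_op i (nil_op (Suc i) (nil_op i g)) = nil_op (Suc i) (nil_op i (nil_op (Suc i) g))"
proof -
  have "w \<circ> sgen i \<circ> sgen (Suc i) \<circ> sgen i = w \<circ> sgen (Suc i) \<circ> sgen i \<circ> sgen (Suc i)" for w :: "int \<Rightarrow> int"
    using sgen_braid[OF assms] by (simp only: comp_assoc)
  then show ?thesis by (intro ext) (simp only: nil_op_3)
qed

lemma nil_op_add: "nil_op i (\<lambda>w. f w + g w) = (\<lambda>w. nil_op i f w + nil_op i g w)"
  and nil_op_mult: "nil_op i (\<lambda>w. t * g w) = (\<lambda>w. t * nil_op i g w)"
  by (auto simp: nil_op_def)

section \<open>Relations among the factors h_i(t)\<close>

lemma hfac_eq: "hfac i t g = (\<lambda>w. g w + t * nil_op i g w)"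
  by (simp add: hfac_def fun_eq_iff)

lemma hfac_merge: "hprod [(i, a), (i, b)] = hprod [(i, a + b)]"
  by (rule ext) (simp add: hfac_eq nil_op_add nil_op_mult nil_op_square algebra_simps)

lemma hfac_zero: "hprod [(i, 0)] = hprod []"
  by (rule ext) (simp add: hfac_eq)

lemma hfac_commute:
  assumes "i + 2 \<le> j" shows "hprod [(i, a), (j, b)] = hprod [(j, b), (i, a)]"
  by (rule ext) (simp add: hfac_eq nil_op_add nil_op_mult nil_op_commute[OF assms] algebra_simps)

text \<open>After expansion the squares of u_i and u_{i+1} vanish, the linear and mixed quadratic
  terms coincide, and the cubic terms, both with coefficient ab(a + b), agree by the braid
  relation.\<close>

lemma hfac_yang_baxter:
  assumes "i > 0"
  shows "hprod [(Suc i, a), (i, a + b), (Suc i, b)] = hprod [(i, b), (Suc i, a + b), (i, a)]"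
  by (rule ext) (simp add: hfac_eq nil_op_add nil_op_mult nil_op_square nil_op_braid[OF assms]
      algebra_simps)

lemma hprod_commute_list:
  assumes "\<And>j b. (j, b) \<in> set L \<Longrightarrow> i + 2 \<le> j"
  shows "hprod ((i, a) # L) = hprod (L @ [(i, a)])"
  using assms
proof (induction L)
  case (Cons p L)
  obtain j b where p: "p = (j, b)" by (cases p)
  have "hprod ((i, a) # p # L) = hprod ([] @ [(j, b), (i, a)] @ L)"
    using hprod_cong[OF hfac_commute[of i j a b], of "[]" L] Cons.prems[of j b] p by simp
  also have "\<dots> = hprod ([p] @ ((i, a) # L) @ [])" by (simp add: p)
  also have "\<dots> = hprod ([p] @ (L @ [(i, a)]) @ [])"
    using Cons.prems by (intro hprod_cong Cons.IH) auto
  finally show ?case by simp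
qed simp

text \<open>The product A_i(t) as a list of factors: one staircase row read from right to left, or
  for \<open>i = 0\<close> the horizontal part of a \<Gamma>-block.\<close>

definition down :: "nat \<Rightarrow> nat \<Rightarrow> 'a \<Rightarrow> (nat \<times> 'a) list" where
  "down n i t = map (\<lambda>j. (j, t)) (rev [i..<n])"

definition up :: "nat \<Rightarrow> nat \<Rightarrow> 'a \<Rightarrow> (nat \<times> 'a) list" where
  "up n i t = map (\<lambda>j. (j, t)) [i..<n]"

lemma down_unfold: "i < n \<Longrightarrow> down n i t = down n (Suc i) t @ [(i, t)]"
  by (simp add: down_def upt_conv_Cons)

lemma down_empty: "n \<le> i \<Longrightarrow> down n i t = []"
  by (simp add: down_def)

lemma down_index: "(j, b) \<in> set (down n i t) \<Longrightarrow> i \<le> j"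
  by (auto simp: down_def)

text \<open>Induction on the number of indices above \<open>i\<close>. Moving h_i(a) past A_{i+2}(b)
  exposes the same situation one index higher; the correction h_{i+1}(a - b) produced there is
  turned into h_i(a - b) by Yang-Baxter.\<close>

lemma down_swap:
  assumes "i > 0" "i < n"
  shows "hprod (down n i a @ down n (Suc i) b) =
    hprod (down n i b @ down n (Suc i) a @ [(i, a - b :: 'a::comm_ring_1)])"
  using assms
proof (induction "n - Suc i" arbitrary: i)
  case 0
  then have n: "n = Suc i" by simp
  have "hprod [(i, b), (i, a - b)] = hprod [(i, a)]" by (subst hfac_merge) simp
  moreover have "down n i t = [(i, t)]" "down n (Suc i) t = []" for t :: 'a
    by (simp_all add: down_def n)
  ultimately show ?case by simp
next
  case (Suc m)
  then have i: "Suc i < n" by simp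
  let ?d = "down n (Suc (Suc i))"
  have com: "hprod ((i, t) # ?d s) = hprod (?d s @ [(i, t)])" for s t
    by (rule hprod_commute_list) (auto dest: down_index)
  have "hprod (down n i a @ down n (Suc i) b) =
      hprod (down n (Suc i) a @ ((i, a) # ?d b) @ [(Suc i, b)])"
    using i by (simp add: down_unfold[of i] down_unfold[of "Suc i"])
  also have "\<dots> = hprod (down n (Suc i) a @ (?d b @ [(i, a)]) @ [(Suc i, b)])"
    by (rule hprod_cong[OF com])
  also have "\<dots> = hprod ([] @ (down n (Suc i) a @ ?d b) @ [(i, a), (Suc i, b)])" by simp
  also have "\<dots> = hprod ([] @ (down n (Suc i) b @ ?d a @ [(Suc i, a - b)]) @ [(i, a), (Suc i, b)])"
    using Suc i by (intro hprod_cong) auto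
  \<comment> \<open>Here \<open>a\<close> is written as \<open>a - b + b\<close>, so that the middle
    parameter is the sum of the outer ones.\<close>
  also have "\<dots> = hprod ((down n (Suc i) b @ ?d a) @ [(Suc i, a - b), (i, a - b + b), (Suc i, b)] @ [])"
    by simp
  also have "\<dots> = hprod ((down n (Suc i) b @ ?d a) @ [(i, b), (Suc i, a - b + b), (i, a - b)] @ [])"
    by (rule hprod_cong[OF hfac_yang_baxter[OF Suc.prems(1)]])
  also have "\<dots> = hprod (down n (Suc i) b @ (?d a @ [(i, b)]) @ [(Suc i, a), (i, a - b)])" by simp
  also have "\<dots> = hprod (down n (Suc i) b @ ((i, b) # ?d a) @ [(Suc i, a), (i, a - b)])"
    by (rule hprod_cong[OF com[symmetric]])
  also have "\<dots> = hprod (down n i b @ down n (Suc i) a @ [(i, a - b)])"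
    using i by (simp add: down_unfold[of i] down_unfold[of "Suc i"])
  finally show ?case .
qed

text \<open>The two factors of largest index meet in the middle and merge to h_n(0) = 1; induction
  removes the next pair.\<close>

lemma up_down_cancel: "hprod (up n i a @ down n i (- a)) = hprod []"
proof (induction n)
  case (Suc n)
  show ?case
  proof (cases "i \<le> n")
    case True
    have "hprod (up (Suc n) i a @ down (Suc n) i (- a)) =
        hprod (up n i a @ [(n, a), (n, - a)] @ down n i (- a))"
      using True by (simp add: up_def down_def)
    also have "\<dots> = hprod (up n i a @ [] @ down n i (- a))"
      by (rule hprod_cong) (simp only: hfac_merge hfac_zero add.right_inverse)
    finally show ?thesis using Suc by simp
  qed (simp add: up_def down_def)
qed (simp add: up_def down_def)

text \<open>The product B(t). The factor h_0(t) occurs twice, once for each of the two boxes of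
  index 0 in a \<Gamma>-block.\<close>

definition gamma :: "nat \<Rightarrow> 'a \<Rightarrow> (nat \<times> 'a) list" where
  "gamma n t = down n 0 t @ up n 0 t"

definition rows :: "nat \<Rightarrow> nat \<Rightarrow> (nat \<Rightarrow> 'a) \<Rightarrow> (nat \<times> 'a) list" where
  "rows n i z = concat (map (\<lambda>j. down n j (z j)) [i..<n])"

definition gblocks :: "nat \<Rightarrow> 'a list \<Rightarrow> (nat \<times> 'a) list" where
  "gblocks n xs = concat (map (gamma n) xs)"

text \<open>The product G, with arbitrary ring elements for the variables. The list
  \<open>xs\<close> runs from the top \<Gamma>-block to the bottom one, so its last entry stands
  next to the staircase rows.\<close>

definition dream_factors :: "nat \<Rightarrow> 'a list \<Rightarrow> (nat \<Rightarrow> 'a) \<Rightarrow> (nat \<times> 'a) list" where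
  "dream_factors n xs z = gblocks n xs @ rows n 1 z"

lemma rows_unfold: "i < n \<Longrightarrow> rows n i z = down n i (z i) @ rows n (Suc i) z"
  by (simp add: rows_def upt_conv_Cons)

lemma rows_empty: "n \<le> i \<Longrightarrow> rows n i z = []"
  by (simp add: rows_def)

lemma rows_index: "(j, b) \<in> set (rows n i z) \<Longrightarrow> i \<le> j"
  by (auto simp: rows_def dest: down_index)

lemma rows_cong: "(\<And>j. i \<le> j \<Longrightarrow> j < n \<Longrightarrow> y j = z j) \<Longrightarrow> rows n i y = rows n i z"
  by (auto simp: rows_def intro!: arg_cong[of _ _ concat])

lemma rows_split: "i \<le> j \<Longrightarrow> j \<le> n \<Longrightarrow>
    rows n i z = concat (map (\<lambda>j. down n j (z j)) [i..<j]) @ rows n j z"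
  unfolding rows_def using upt_add_eq_append[of i j "n - j"] by simp

text \<open>\<open>down_swap\<close> exchanges the parameters of rows \<open>i\<close> and
  \<open>i + 1\<close>; its correction factor commutes with the later rows, whose indices are at
  least \<open>i + 2\<close>. If \<open>n = i + 1\<close>, row \<open>i\<close> is a single factor
  and merging suffices.\<close>

lemma rows_swap:
  assumes "0 < i" "i < n"
  shows "hprod (rows n i (z \<circ> transpose i (Suc i))) =
    hprod (rows n i z @ [(i, z (Suc i) - z i :: 'a::comm_ring_1)])"
proof (cases "Suc i < n")
  case False
  then have n: "n = Suc i" using assms by simp
  have "hprod [(i, z i), (i, z (Suc i) - z i)] = hprod [(i, z (Suc i))]"
    by (subst hfac_merge) simp
  moreover have "rows n i y = [(i, y i)]" for y :: "nat \<Rightarrow> 'a"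
    by (simp add: rows_def down_def n)
  ultimately show ?thesis by simp
next
  case True
  let ?r = "rows n (Suc (Suc i)) z"
  have "rows n (Suc (Suc i)) (z \<circ> transpose i (Suc i)) = ?r"
    by (rule rows_cong) (simp add: transpose_def)
  then have "hprod (rows n i (z \<circ> transpose i (Suc i))) =
      hprod ([] @ (down n i (z (Suc i)) @ down n (Suc i) (z i)) @ ?r)"
    using True by (simp add: rows_unfold[of i] rows_unfold[of "Suc i"])
  also have "\<dots> = hprod ([] @
      (down n i (z i) @ down n (Suc i) (z (Suc i)) @ [(i, z (Suc i) - z i)]) @ ?r)"
    using assms by (intro hprod_cong down_swap)
  also have "\<dots> = hprod ((down n i (z i) @ down n (Suc i) (z (Suc i))) @
      ((i, z (Suc i) - z i) # ?r) @ [])" by simp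
  also have "\<dots> = hprod ((down n i (z i) @ down n (Suc i) (z (Suc i))) @
      (?r @ [(i, z (Suc i) - z i)]) @ [])"
    by (intro hprod_cong hprod_commute_list) (auto dest: rows_index)
  also have "\<dots> = hprod (rows n i z @ [(i, z (Suc i) - z i)])"
    using True by (simp add: rows_unfold[of i] rows_unfold[of "Suc i"])
  finally show ?thesis .
qed

lemma dream_factors_swap:
  assumes "0 < i" "i < n"
  shows "hprod (dream_factors n xs (z \<circ> transpose i (Suc i))) =
    hprod (dream_factors n xs z @ [(i, z (Suc i) - z i :: 'a::comm_ring_1)])"
proof -
  let ?h = "\<lambda>z. concat (map (\<lambda>j. down n j (z j)) [1..<i])"
  have h: "?h (z \<circ> transpose i (Suc i)) = ?h z"
    by (intro arg_cong[of _ _ concat] map_cong) (auto simp: transpose_def)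
  have r: "rows n 1 z = ?h z @ rows n i z" for z
    using assms by (intro rows_split) auto
  have "hprod (dream_factors n xs (z \<circ> transpose i (Suc i))) =
      hprod ((gblocks n xs @ ?h z) @ rows n i (z \<circ> transpose i (Suc i)) @ [])"
    by (simp only: dream_factors_def r h append_assoc append_Nil2)
  also have "\<dots> = hprod ((gblocks n xs @ ?h z) @ (rows n i z @ [(i, z (Suc i) - z i)]) @ [])"
    by (rule hprod_cong[OF rows_swap[OF assms]])
  finally show ?thesis by (simp add: dream_factors_def r del: One_nat_def)
qed

text \<open>The increasing half of B(t) above index 0 cancels against A_1(-t). What remains is
  A_1(t) followed by two factors h_0(t), which merge.\<close>

lemma gamma_down: "n > 0 \<Longrightarrow> hprod (gamma n t @ down n 1 (- t)) = hprod (down n 1 t @ [(0, 2 * t)])"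
proof -
  assume n: "n > 0"
  have "hprod (gamma n t @ down n 1 (- t)) =
      hprod (down n 0 t @ [(0, t)] @ (up n 1 t @ down n 1 (- t)))"
    using n by (simp add: gamma_def up_def upt_conv_Cons)
  also have "\<dots> = hprod ((down n 0 t @ [(0, t)]) @ [] @ [])"
    using hprod_cong[OF up_down_cancel[of n 1 t], of "down n 0 t @ [(0, t)]" "[]"] by simp
  also have "\<dots> = hprod (down n 1 t @ [(0, t), (0, t)] @ [])"
    using n by (simp add: down_unfold[of 0])
  also have "\<dots> = hprod (down n 1 t @ [(0, t + t)] @ [])"
    by (rule hprod_cong[OF hfac_merge])
  finally show ?thesis by (simp only: mult_2 append_Nil2)
qed

text \<open>Appending \<open>z 1\<close> to \<open>xs\<close> puts B(z_1) directly before row 1, now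
  with parameter -z_1. After \<open>gamma_down\<close> the factor h_0(2 z_1) commutes past the rows
  from 2 on.\<close>

lemma dream_factors_reflect:
  assumes "n > 0"
  shows "hprod (dream_factors n (xs @ [z 1]) (z(1 := - z 1))) =
    hprod (dream_factors n xs z @ [(0, 2 * z 1 :: 'a::comm_ring_1)])"
proof -
  have r: "rows n 1 y = down n 1 (y 1) @ rows n 2 y" for y :: "nat \<Rightarrow> 'a"
    using rows_unfold[of 1 n] by (cases "1 < n") (auto simp: rows_empty down_empty numeral_2_eq_2)
  have r2: "rows n 2 (z(1 := - z 1)) = rows n 2 z" by (rule rows_cong) simp
  have "hprod (dream_factors n (xs @ [z 1]) (z(1 := - z 1))) =
      hprod (gblocks n xs @ (gamma n (z 1) @ down n 1 (- z 1)) @ rows n 2 z)"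
    by (simp add: dream_factors_def gblocks_def r r2 del: One_nat_def)
  also have "\<dots> = hprod (gblocks n xs @ (down n 1 (z 1) @ [(0, 2 * z 1)]) @ rows n 2 z)"
    by (rule hprod_cong[OF gamma_down[OF assms]])
  also have "\<dots> = hprod ((gblocks n xs @ down n 1 (z 1)) @ ((0, 2 * z 1) # rows n 2 z) @ [])"
    by simp
  also have "\<dots> = hprod ((gblocks n xs @ down n 1 (z 1)) @ (rows n 2 z @ [(0, 2 * z 1)]) @ [])"
    by (intro hprod_cong hprod_commute_list) (auto dest: rows_index)
  finally show ?thesis by (simp add: dream_factors_def r del: One_nat_def)
qed

text \<open>The coefficient of \<open>u\<^sub>w\<close> in the product of the factors \<open>1 + t u\<^sub>i\<close>.\<close>

definition nil_coeff :: "(nat \<times> 'a) list \<Rightarrow> (int \<Rightarrow> int) \<Rightarrow> 'a::comm_ring_1" where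
  "nil_coeff L = hprod L (\<lambda>w. if w = id then 1 else 0)"

lemma nil_coeff_snoc:
  "nil_coeff (L @ [(i, t)]) w = nil_coeff L w + t * nil_op i (nil_coeff L) w"
  by (simp add: nil_coeff_def hprod_append hfac_def)

lemma nil_coeff_swap:
  assumes "0 < i" "i < n"
  shows "nil_coeff (dream_factors n xs (z \<circ> transpose i (Suc i))) w =
    nil_coeff (dream_factors n xs z) w +
    (z (Suc i) - z i) * nil_op i (nil_coeff (dream_factors n xs z)) w"
  unfolding nil_coeff_snoc[symmetric] by (simp add: nil_coeff_def dream_factors_swap[OF assms])

lemma nil_coeff_reflect:
  assumes "0 < n"
  shows "nil_coeff (dream_factors n (xs @ [z 1]) (z(1 := - z 1))) w =
    nil_coeff (dream_factors n xs z) w +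
    2 * z 1 * nil_op 0 (nil_coeff (dream_factors n xs z)) w"
  unfolding nil_coeff_snoc[symmetric] by (simp add: nil_coeff_def dream_factors_reflect[OF assms] del: One_nat_def)

section \<open>Substitution and divided differences\<close>

fun var_code :: "var \<Rightarrow> nat" where
  "var_code (X i) = 3 * i"
| "var_code (Z i) = 3 * i + 1"
| "var_code (P i) = 3 * i + 2"

lemma var_code_inj: "var_code u = var_code v \<longleftrightarrow> u = v"
  by (cases u; cases v) (auto, presburger+)

text \<open>An arbitrary linear order on the variables makes \<open>polyQ\<close> an instance of \<open>idom\<close>.\<close>

instantiation var :: linorder
begin

definition less_eq_var :: "var \<Rightarrow> var \<Rightarrow> bool" where
  "less_eq_var u v \<longleftrightarrow> var_code u \<le> var_code v"

definition less_var :: "var \<Rightarrow> var \<Rightarrow> bool" where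
  "less_var u v \<longleftrightarrow> var_code u < var_code v"

instance
  by standard (auto simp: less_eq_var_def less_var_def var_code_inj)

end

section \<open>Substitution as a ring homomorphism\<close>

abbreviation const :: "rat \<Rightarrow> polyQ" where
  "const c \<equiv> Poly_Mapping.single 0 c"

definition monom_value :: "(var \<Rightarrow> polyQ) \<Rightarrow> (var \<Rightarrow>\<^sub>0 nat) \<Rightarrow> polyQ" where
  "monom_value \<sigma> m = (\<Prod>v\<in>Poly_Mapping.keys m. \<sigma> v ^ Poly_Mapping.lookup m v)"

lemma monom_value_superset:
  assumes "finite S" "Poly_Mapping.keys m \<subseteq> S"
  shows "monom_value \<sigma> m = (\<Prod>v\<in>S. \<sigma> v ^ Poly_Mapping.lookup m v)"
  unfolding monom_value_def
  by (rule prod.mono_neutral_left) (use assms in \<open>auto simp: in_keys_iff\<close>)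

lemma monom_value_0 [simp]: "monom_value \<sigma> 0 = 1"
  by (simp add: monom_value_def)

lemma monom_value_single [simp]: "monom_value \<sigma> (Poly_Mapping.single v k) = \<sigma> v ^ k"
  by (subst monom_value_superset[of "{v}"]) auto

lemma monom_value_add: "monom_value \<sigma> (m + m') = monom_value \<sigma> m * monom_value \<sigma> m'"
proof -
  let ?S = "Poly_Mapping.keys m \<union> Poly_Mapping.keys m'"
  have "Poly_Mapping.keys (m + m') \<subseteq> ?S" by (rule keys_add)
  then show ?thesis
    by (simp add: monom_value_superset[of ?S] lookup_add power_add prod.distrib)
qed

lemma poly_subst_eq:
  "poly_subst \<sigma> f = (\<Sum>m\<in>Poly_Mapping.keys f. const (Poly_Mapping.lookup f m) * monom_value \<sigma> m)"
  by (simp add: poly_subst_def monom_value_def)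

lemma poly_subst_superset:
  assumes "finite S" "Poly_Mapping.keys f \<subseteq> S"
  shows "poly_subst \<sigma> f = (\<Sum>m\<in>S. const (Poly_Mapping.lookup f m) * monom_value \<sigma> m)"
  unfolding poly_subst_eq
  by (rule sum.mono_neutral_left) (use assms in \<open>auto simp: in_keys_iff\<close>)

lemma poly_subst_single: "poly_subst \<sigma> (Poly_Mapping.single m c) = const c * monom_value \<sigma> m"
  by (subst poly_subst_superset[of "{m}"]) auto

lemma poly_subst_const [simp]: "poly_subst \<sigma> (const c) = const c"
  by (simp add: poly_subst_single)

lemma poly_subst_Var [simp]: "poly_subst \<sigma> (Var v) = \<sigma> v"
  by (simp add: Var_def poly_subst_single)

lemma poly_subst_add: "poly_subst \<sigma> (f + g) = poly_subst \<sigma> f + poly_subst \<sigma> g"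
proof -
  let ?S = "Poly_Mapping.keys f \<union> Poly_Mapping.keys g"
  have "Poly_Mapping.keys (f + g) \<subseteq> ?S" by (rule keys_add)
  then show ?thesis
    by (simp add: poly_subst_superset[of ?S] lookup_add single_add distrib_right sum.distrib)
qed

lemma poly_subst_0 [simp]: "poly_subst \<sigma> 0 = 0"
  by (simp add: poly_subst_eq)

lemma poly_subst_1 [simp]: "poly_subst \<sigma> 1 = 1"
  using poly_subst_const[of \<sigma> 1] by simp

lemma poly_subst_uminus: "poly_subst \<sigma> (- f) = - poly_subst \<sigma> f"
  using poly_subst_add[of \<sigma> f "- f"] by (simp add: eq_neg_iff_add_eq_0 add.commute)

lemma poly_subst_diff: "poly_subst \<sigma> (f - g) = poly_subst \<sigma> f - poly_subst \<sigma> g"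
  using poly_subst_add[of \<sigma> f "- g"] by (simp add: poly_subst_uminus)

lemma poly_subst_sum: "poly_subst \<sigma> (\<Sum>i\<in>A. f i) = (\<Sum>i\<in>A. poly_subst \<sigma> (f i))"
  by (induction A rule: infinite_finite_induct) (auto simp: poly_subst_add)

lemma sum_singles: "f = (\<Sum>m\<in>Poly_Mapping.keys f. Poly_Mapping.single m (Poly_Mapping.lookup f m))"
proof (rule poly_mapping_eqI)
  fix m
  show "Poly_Mapping.lookup f m = Poly_Mapping.lookup
      (\<Sum>m\<in>Poly_Mapping.keys f. Poly_Mapping.single m (Poly_Mapping.lookup f m)) m"
    by (simp add: lookup_sum lookup_single when_def in_keys_iff)
qed

lemma poly_subst_mult: "poly_subst \<sigma> (f * g) = poly_subst \<sigma> f * poly_subst \<sigma> g"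
proof -
  let ?s = "\<lambda>f m. Poly_Mapping.single m (Poly_Mapping.lookup f m)"
  have "f * g = (\<Sum>m\<in>Poly_Mapping.keys f. ?s f m) * (\<Sum>m\<in>Poly_Mapping.keys g. ?s g m)"
    using sum_singles[of f] sum_singles[of g] by simp
  then have "poly_subst \<sigma> (f * g) =
      (\<Sum>m\<in>Poly_Mapping.keys f. \<Sum>m'\<in>Poly_Mapping.keys g. poly_subst \<sigma> (?s f m * ?s g m'))"
    by (simp add: sum_product poly_subst_sum)
  also have "\<dots> = (\<Sum>m\<in>Poly_Mapping.keys f. \<Sum>m'\<in>Poly_Mapping.keys g.
      (const (Poly_Mapping.lookup f m) * monom_value \<sigma> m) *
      (const (Poly_Mapping.lookup g m') * monom_value \<sigma> m'))"
  proof (intro sum.cong refl)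
    fix m m'
    have "const (a * b) = const a * const b" for a b
      by (simp add: mult_single)
    then show "poly_subst \<sigma> (?s f m * ?s g m') =
      (const (Poly_Mapping.lookup f m) * monom_value \<sigma> m) *
      (const (Poly_Mapping.lookup g m') * monom_value \<sigma> m')"
      by (simp add: mult_single poly_subst_single monom_value_add mult_ac)
  qed
  finally show ?thesis by (simp add: poly_subst_eq sum_product)
qed

lemma poly_subst_power: "poly_subst \<sigma> (f ^ k) = poly_subst \<sigma> f ^ k"
  by (induction k) (auto simp: poly_subst_mult)

lemma poly_subst_prod: "poly_subst \<sigma> (\<Prod>i\<in>A. f i) = (\<Prod>i\<in>A. poly_subst \<sigma> (f i))"
  by (induction A rule: infinite_finite_induct) (auto simp: poly_subst_mult)

lemma poly_subst_numeral [simp]: "poly_subst \<sigma> (numeral k) = numeral k"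
  by (metis poly_subst_const single_numeral)

lemma poly_subst_poly_subst:
  "poly_subst \<tau> (poly_subst \<sigma> f) = poly_subst (\<lambda>v. poly_subst \<tau> (\<sigma> v)) f"
  by (simp add: poly_subst_eq[of \<sigma>] poly_subst_eq[of "\<lambda>v. poly_subst \<tau> (\<sigma> v)"]
      poly_subst_sum poly_subst_mult monom_value_def poly_subst_prod poly_subst_power)

lemma poly_subst_cong:
  assumes "\<And>m v. m \<in> Poly_Mapping.keys f \<Longrightarrow> v \<in> Poly_Mapping.keys m \<Longrightarrow> \<sigma> v = \<tau> v"
  shows "poly_subst \<sigma> f = poly_subst \<tau> f"
  unfolding poly_subst_eq monom_value_def using assms by (auto intro!: sum.cong prod.cong)

lemma monom_value_Var: "monom_value Var m = Poly_Mapping.single m 1"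
proof -
  have "Var v ^ k = Poly_Mapping.single (Poly_Mapping.single v k) 1" for v k
    by (induction k) (auto simp: Var_def mult_single single_add[symmetric])
  then have "monom_value Var m =
      (\<Prod>v\<in>Poly_Mapping.keys m. Poly_Mapping.single (Poly_Mapping.single v (Poly_Mapping.lookup m v)) 1)"
    by (simp add: monom_value_def)
  also have "\<dots> = Poly_Mapping.single
      (\<Sum>v\<in>Poly_Mapping.keys m. Poly_Mapping.single v (Poly_Mapping.lookup m v)) 1"
  proof -
    have "(\<Prod>v\<in>A. Poly_Mapping.single (g v) 1) = (Poly_Mapping.single (\<Sum>v\<in>A. g v) 1 :: polyQ)"
      for A and g :: "var \<Rightarrow> var \<Rightarrow>\<^sub>0 nat"
      by (induction A rule: infinite_finite_induct) (auto simp: mult_single)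
    then show ?thesis .
  qed
  also have "\<dots> = Poly_Mapping.single m 1"
  proof -
    have "(\<Sum>v\<in>Poly_Mapping.keys m. Poly_Mapping.single v (Poly_Mapping.lookup m v)) = m"
      by (rule poly_mapping_eqI) (simp add: lookup_sum lookup_single when_def in_keys_iff)
    then show ?thesis by simp
  qed
  finally show ?thesis .
qed

lemma poly_subst_ident [simp]: "poly_subst Var f = f"
  unfolding poly_subst_eq monom_value_Var
  by (subst (3) sum_singles) (simp add: mult_single)

text \<open>Congruence modulo \<open>d\<close> is compatible with products and powers, so it passes
  from variables to monomials.\<close>

lemma dvd_monom_value_diff:
  assumes "\<And>v. v \<in> Poly_Mapping.keys m \<Longrightarrow> d dvd \<sigma> v - \<tau> v"
  shows "d dvd monom_value \<sigma> m - monom_value \<tau> m"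
proof -
  have mult: "d dvd a * b - a' * b'" if "d dvd a - a'" "d dvd b - b'" for a b a' b' :: polyQ
  proof -
    have "a * b - a' * b' = (a - a') * b + a' * (b - b')" by (simp add: algebra_simps)
    then show ?thesis using that by (metis dvd_add dvd_mult dvd_mult2)
  qed
  have pow: "d dvd a ^ k - a' ^ k" if "d dvd a - a'" for a a' :: polyQ and k
    by (induction k) (use that mult in auto)
  have "d dvd (\<Prod>v\<in>A. \<sigma> v ^ Poly_Mapping.lookup m v) - (\<Prod>v\<in>A. \<tau> v ^ Poly_Mapping.lookup m v)"
    if "A \<subseteq> Poly_Mapping.keys m" for A
    using finite_subset[OF that finite_keys] that
    by (induction A rule: finite_induct) (auto intro!: mult pow assms)
  then show ?thesis unfolding monom_value_def by simp
qed

lemma dvd_poly_subst_diff: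
  assumes "\<And>m v. m \<in> Poly_Mapping.keys f \<Longrightarrow> v \<in> Poly_Mapping.keys m \<Longrightarrow> d dvd \<sigma> v - \<tau> v"
  shows "d dvd poly_subst \<sigma> f - poly_subst \<tau> f"
  unfolding poly_subst_eq sum_subtractf[symmetric] right_diff_distrib[symmetric]
  using assms by (intro dvd_sum dvd_mult dvd_monom_value_diff) auto

lemma Var_eq_iff: "Var u = Var v \<longleftrightarrow> u = v"
  by (auto simp: Var_def dest!: arg_cong[of _ _ Poly_Mapping.keys])

lemma Var_neq_0: "Var v \<noteq> 0"
  by (auto simp: Var_def dest!: arg_cong[of _ _ Poly_Mapping.keys])

section \<open>Exactness of divided differences\<close>

lemma divdiff_denom_nonzero: "divdiff_denom i \<noteq> 0"
  by (auto simp: divdiff_denom_def Var_eq_iff Var_neq_0)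

lemma ring_ZP_vars:
  assumes "f \<in> ring_ZP" "m \<in> Poly_Mapping.keys f" "v \<in> Poly_Mapping.keys m"
  obtains j where "v = Z j" "j \<ge> 1" | j where "v = P j" "odd j"
proof -
  have "v \<in> {Z i | i. i \<ge> 1} \<union> {P j | j. odd j}"
    using assms unfolding ring_ZP_def by blast
  then show ?thesis using that by blast
qed

text \<open>It suffices to compare variables with their images: the differences are 0, z_i - z_{i+1}
  up to sign, 2 z_1, or -z_1^j with \<open>j\<close> odd. The last is divisible by -2 z_1 because
  \<open>j\<close> is positive and 2 is invertible in the rationals.\<close>

lemma divdiff_denom_dvd:
  assumes "f \<in> ring_ZP" shows "divdiff_denom i dvd f - act i f"
proof -
  have "divdiff_denom i dvd poly_subst Var f - poly_subst (act_var i) f"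
  proof (rule dvd_poly_subst_diff)
    fix m v assume "m \<in> Poly_Mapping.keys f" "v \<in> Poly_Mapping.keys m"
    with assms show "divdiff_denom i dvd Var v - act_var i v"
    proof (cases rule: ring_ZP_vars)
      case (1 j)
      have "- (2 * Var (Z 1)) dvd 2 * Var (Z 1)"
        and "Var (Z i) - Var (Z (Suc i)) dvd Var (Z (Suc i)) - Var (Z i)"
        by (metis minus_dvd_iff dvd_refl, metis minus_diff_eq dvd_minus_iff dvd_refl)
      then show ?thesis using 1
        by (auto simp: divdiff_denom_def transpose_def mult_2[symmetric])
    next
      case (2 j)
      show ?thesis
      proof (cases "i = 0")
        case True
        obtain k where k: "j = Suc k" using 2 by (cases j) auto
        have half: "2 * const (1 / 2) = 1"
          by (simp add: single_numeral[symmetric] mult_single del: single_numeral)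
        have "- (2 * Var (Z 1)) * (const (1 / 2) * Var (Z 1) ^ k) =
            - ((2 * const (1 / 2)) * Var (Z 1) ^ j)"
          by (simp add: k mult_ac)
        also have "\<dots> = Var v - act_var i v" using 2 True by (simp add: half)
        finally show ?thesis using True
          by (metis divdiff_denom_def dvd_triv_left mult_minus_left)
      qed (use 2 in simp)
    qed
  qed
  then show ?thesis by (simp add: act_def)
qed

text \<open>The description in \<open>divdiff\<close> is met: a quotient exists by divisibility and
  is unique by cancellation in an integral domain.\<close>

lemma divdiff_exact:
  assumes "f \<in> ring_ZP" shows "divdiff_denom i * divdiff i f = f - act i f"
proof -
  obtain g where g: "f - act i f = divdiff_denom i * g"
    using divdiff_denom_dvd[OF assms] by (auto simp: dvd_def)
  have "divdiff i f = g" unfolding divdiff_def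
    by (rule the_equality) (use g divdiff_denom_nonzero in auto)
  then show ?thesis using g by simp
qed

text \<open>The p_m become power sums of a finite list of ring elements, so that the shift of p_m by
  z_1^m under s_0 is the adjunction of one more entry to the list.\<close>

fun eval_var :: "polyQ list \<Rightarrow> (nat \<Rightarrow> polyQ) \<Rightarrow> var \<Rightarrow> polyQ" where
  "eval_var xs z (X j) = Var (X j)"
| "eval_var xs z (Z j) = z j"
| "eval_var xs z (P m) = (\<Sum>x\<leftarrow>xs. x ^ m)"

definition eval_at :: "polyQ list \<Rightarrow> (nat \<Rightarrow> polyQ) \<Rightarrow> polyQ \<Rightarrow> polyQ" where
  "eval_at xs z = poly_subst (eval_var xs z)"

lemma eval_at_act_swap:
  assumes "i > 0" shows "eval_at xs z (act i f) = eval_at xs (z \<circ> transpose i (Suc i)) f"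
proof -
  have "poly_subst (eval_var xs z) (act_var i v) = eval_var xs (z \<circ> transpose i (Suc i)) v" for v
    using assms by (cases v) auto
  then show ?thesis by (simp add: eval_at_def act_def poly_subst_poly_subst)
qed

lemma eval_at_act_reflect:
  "eval_at xs z (act 0 f) = eval_at (xs @ [z 1]) (z(1 := - z 1)) f"
proof -
  have "poly_subst (eval_var xs z) (act_var 0 v) = eval_var (xs @ [z 1]) (z(1 := - z 1)) v" for v
    by (cases v) (auto simp: poly_subst_add poly_subst_uminus poly_subst_power)
  then show ?thesis by (simp add: eval_at_def act_def poly_subst_poly_subst)
qed

text \<open>The divided difference equation solved for s_i f, in the same shape as
  \<open>nil_coeff_swap\<close>.\<close>

lemma eval_at_swap:
  assumes "f \<in> ring_ZP" "i > 0"
  shows "eval_at xs (z \<circ> transpose i (Suc i)) f =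
    eval_at xs z f + (z (Suc i) - z i) * eval_at xs z (divdiff i f)"
proof -
  have "f - (divdiff_denom i * divdiff i f) = act i f"
    using divdiff_exact[OF assms(1)] by simp
  then have "eval_at xs (z \<circ> transpose i (Suc i)) f =
      eval_at xs z (f - divdiff_denom i * divdiff i f)"
    using eval_at_act_swap[OF assms(2)] by simp
  then show ?thesis using assms(2)
    by (simp add: eval_at_def divdiff_denom_def poly_subst_diff poly_subst_mult poly_subst_add
        algebra_simps)
qed

lemma eval_at_reflect:
  assumes "f \<in> ring_ZP"
  shows "eval_at (xs @ [z 1]) (z(1 := - z 1)) f =
    eval_at xs z f + 2 * z 1 * eval_at xs z (divdiff 0 f)"
proof -
  have "f - (divdiff_denom 0 * divdiff 0 f) = act 0 f"
    using divdiff_exact[OF assms(1)] by simp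
  then have "eval_at (xs @ [z 1]) (z(1 := - z 1)) f =
      eval_at xs z (f - divdiff_denom 0 * divdiff 0 f)"
    using eval_at_act_reflect by simp
  then show ?thesis
    by (simp add: eval_at_def divdiff_denom_def poly_subst_diff poly_subst_mult
        poly_subst_uminus poly_subst_add algebra_simps)
qed

lemma eval_at_finite_support:
  assumes "f \<in> ring_ZP"
  shows "\<exists>N. \<forall>xs y z. (\<forall>i. 1 \<le> i \<and> i \<le> N \<longrightarrow> y i = z i) \<longrightarrow> eval_at xs y f = eval_at xs z f"
proof -
  let ?V = "\<Union>m\<in>Poly_Mapping.keys f. Poly_Mapping.keys m"
  have "finite (Z -` ?V)" by (intro finite_vimageI) (auto simp: inj_def)
  then obtain N where N: "\<And>i. Z i \<in> ?V \<Longrightarrow> i \<le> N"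
    using finite_nat_set_iff_bounded_le by (metis vimageI)
  have "eval_at xs y f = eval_at xs z f" if yz: "\<forall>i. 1 \<le> i \<and> i \<le> N \<longrightarrow> y i = z i" for xs y z
    unfolding eval_at_def
  proof (rule poly_subst_cong)
    fix m v assume mv: "m \<in> Poly_Mapping.keys f" "v \<in> Poly_Mapping.keys m"
    with assms show "eval_var xs y v = eval_var xs z v"
    proof (cases rule: ring_ZP_vars)
      case (1 j)
      then show ?thesis using mv N[of j] yz by auto
    qed simp
  qed
  then show ?thesis by blast
qed

lemma eval_at_origin:
  assumes "f \<in> ring_ZP"
  shows "eval_at [] (\<lambda>_. 0) f = const (Poly_Mapping.lookup f 0)"
proof -
  have z: "monom_value (eval_var [] (\<lambda>_. 0)) m = 0" if m: "m \<in> Poly_Mapping.keys f" "m \<noteq> 0" for m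
  proof -
    obtain v where v: "v \<in> Poly_Mapping.keys m" using m(2) by fastforce
    have "eval_var [] (\<lambda>_. 0) v = 0"
      using assms m(1) v by (cases rule: ring_ZP_vars) auto
    then have "eval_var [] (\<lambda>_. 0) v ^ Poly_Mapping.lookup m v = 0"
      using v by (simp add: in_keys_iff)
    then show ?thesis unfolding monom_value_def using v by (intro prod_zero) auto
  qed
  \<comment> \<open>The exponent 0 is inserted because the constant monomial may be missing from the
    support.\<close>
  have "eval_at [] (\<lambda>_. 0) f = (\<Sum>m\<in>insert 0 (Poly_Mapping.keys f).
      const (Poly_Mapping.lookup f m) * monom_value (eval_var [] (\<lambda>_. 0)) m)"
    unfolding eval_at_def by (rule poly_subst_superset) auto
  also have "\<dots> = (\<Sum>m\<in>{0}. const (Poly_Mapping.lookup f m) * monom_value (eval_var [] (\<lambda>_. 0)) m)"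
    by (rule sum.mono_neutral_right) (auto simp: z)
  finally show ?thesis by simp
qed

lemma act_homogeneous_const:
  assumes "f \<in> ring_ZP" "homogeneous f" "Poly_Mapping.lookup f 0 \<noteq> 0"
  shows "act i f = f"
proof -
  obtain d where d: "\<And>m. m \<in> Poly_Mapping.keys f \<Longrightarrow>
      (\<Sum>v\<in>Poly_Mapping.keys m. var_degree v * Poly_Mapping.lookup m v) = d"
    using assms(2) by (auto simp: homogeneous_def)
  have "0 \<in> Poly_Mapping.keys f" using assms(3) by (simp add: in_keys_iff)
  then have d0: "d = 0" using d[of 0] by simp
  have "m = 0" if m: "m \<in> Poly_Mapping.keys f" for m
  proof (rule ccontr)
    assume "m \<noteq> 0"
    then obtain v where v: "v \<in> Poly_Mapping.keys m" by fastforce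
    have "var_degree v \<noteq> 0"
      using assms(1) m v by (cases rule: ring_ZP_vars) (auto simp: odd_pos)
    moreover have "var_degree v * Poly_Mapping.lookup m v = 0"
      using d[OF m] v unfolding d0 by (subst (asm) sum_eq_0_iff) auto
    ultimately show False using v by (simp add: in_keys_iff)
  qed
  then have "Poly_Mapping.keys f \<subseteq> {0}" by blast
  then have "poly_subst \<sigma> f = const (Poly_Mapping.lookup f 0)" for \<sigma>
    by (subst poly_subst_superset[of "{0}"]) auto
  from this[of "act_var i"] this[of Var] show ?thesis by (simp add: act_def)
qed

lemma truncation_eq_eval_at:
  "truncation k f = eval_at (map (\<lambda>m. Var (X m)) (rev [1..<k + 1])) (\<lambda>i. Var (Z i)) f"
proof -
  have "trunc_var k v = eval_var (map (\<lambda>m. Var (X m)) (rev [1..<k + 1])) (\<lambda>i. Var (Z i)) v" for v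
    by (cases v) (simp_all add: rev_map[symmetric] sum_list_rev comp_def interv_sum_list_conv_sum_set_nat
        atLeastLessThanSuc_atLeastAtMost del: upt_Suc)
  then show ?thesis unfolding truncation_def eval_at_def by (intro poly_subst_cong)
qed

section \<open>Schubert polynomials as nil-Coxeter coefficients\<close>

lemma BC_descent_less:
  assumes "w \<in> BC n" "cox_length (w \<circ> sgen i) < cox_length w" shows "i < n"
proof -
  have w: "w \<in> BC_inf" using assms(1) by (rule BC_subset_BC_inf)
  then obtain a where "a \<in> reduced_words (w \<circ> sgen i)"
    using reduced_words_nonempty BC_inf_comp_sgen by blast
  then have "a @ [i] \<in> reduced_words w" using w assms(2) by (simp add: reduced_words_snoc)
  then show ?thesis using reduced_words_BC_letters[OF _ assms(1)] by force
qed

lemma exists_descent: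
  assumes "w \<in> BC_inf" "w \<noteq> id"
  obtains i where "cox_length (w \<circ> sgen i) < cox_length w"
proof -
  obtain a where a: "a \<in> reduced_words w" using reduced_words_nonempty assms(1) by blast
  then have "a \<noteq> []" using assms(2) by (auto simp: reduced_words_def)
  then obtain b i where "a = b @ [i]" by (cases a rule: rev_cases) auto
  then show ?thesis using a that by (auto simp: reduced_words_snoc)
qed

lemma schubert_C_divdiff:
  assumes "schubert_C_family C" "w \<in> BC_inf"
  shows "divdiff i (C w) = (if cox_length (w \<circ> sgen i) < cox_length w then C (w \<circ> sgen i) else 0)"
    and "C w \<in> ring_ZP" and "homogeneous (C w)"
  using assms by (simp_all add: schubert_C_family_def)

lemma divdiff_eq_0: "f \<in> ring_ZP \<Longrightarrow> act i f = f \<Longrightarrow> divdiff i f = 0"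
  using divdiff_exact[of f i] divdiff_denom_nonzero[of i] by simp

text \<open>Divided differences along descents lead from \<open>C w\<close> down to
  \<open>C id = 1\<close>, and the divided difference of 0 is 0.\<close>

lemma schubert_C_nonzero:
  assumes "schubert_C_family C" "w \<in> BC_inf" shows "C w \<noteq> 0"
  using assms(2)
proof (induction "cox_length w" arbitrary: w rule: less_induct)
  case less
  show ?case
  proof (cases "w = id")
    case True
    then show ?thesis using assms(1) by (simp add: schubert_C_family_def)
  next
    case False
    then obtain i where i: "cox_length (w \<circ> sgen i) < cox_length w"
      using exists_descent less.prems by blast
    have "C (w \<circ> sgen i) \<noteq> 0"
      by (rule less.hyps[OF i]) (simp only: BC_inf_comp_sgen less.prems)
    then have "divdiff i (C w) \<noteq> 0" using schubert_C_divdiff(1)[OF assms(1) less.prems] i by simp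
    moreover have "divdiff i 0 = 0"
      by (rule divdiff_eq_0) (simp_all add: ring_ZP_def act_def)
    ultimately show ?thesis by auto
  qed
qed

text \<open>For \<open>w\<close> other than the identity, a nonzero constant term would make
  \<open>C w\<close> a constant by homogeneity; all its divided differences would vanish, although
  the one at a descent is the nonzero polynomial of w s_i.\<close>

lemma schubert_C_constant_term:
  assumes "schubert_C_family C" "w \<in> BC_inf"
  shows "Poly_Mapping.lookup (C w) 0 = (if w = id then 1 else 0)"
proof (cases "w = id")
  case True
  then show ?thesis using assms(1) by (simp add: schubert_C_family_def lookup_one)
next
  case False
  obtain i where i: "cox_length (w \<circ> sgen i) < cox_length w"
    using exists_descent assms(2) False by blast
  have "C (w \<circ> sgen i) \<noteq> 0"
    by (rule schubert_C_nonzero[OF assms(1)]) (simp only: BC_inf_comp_sgen assms(2))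
  then have "divdiff i (C w) \<noteq> 0" using schubert_C_divdiff(1)[OF assms] i by simp
  then have "Poly_Mapping.lookup (C w) 0 = 0"
    using divdiff_eq_0 act_homogeneous_const schubert_C_divdiff(2,3)[OF assms] by blast
  then show ?thesis using False by simp
qed

text \<open>A function of infinitely many variables that is symmetric and depends on finitely many of
  them is constant, since every variable can be exchanged with an irrelevant one.\<close>

lemma symmetric_finite_support_const:
  fixes E :: "(nat \<Rightarrow> 'a) \<Rightarrow> 'b"
  assumes swap: "\<And>i z. i > 0 \<Longrightarrow> E (z \<circ> transpose i (Suc i)) = E z"
    and supp: "\<And>y z. (\<And>i. 1 \<le> i \<Longrightarrow> i \<le> N \<Longrightarrow> y i = z i) \<Longrightarrow> E y = E z"
  shows "E y = E z"
proof -
  have swaps: "E (z \<circ> transpose i (Suc (i + d))) = E z" if "i > 0" for i d z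
  proof (induction d arbitrary: z)
    case 0
    show ?case using swap[OF that, of z] by (simp only: add_0_right)
  next
    case (Suc d)
    let ?j = "Suc (i + d)"
    \<comment> \<open>A longer transposition is a shorter one conjugated by an adjacent one.\<close>
    have t: "transpose i (Suc ?j) = transpose ?j (Suc ?j) \<circ> transpose i ?j \<circ> transpose ?j (Suc ?j)"
      by (auto simp: fun_eq_iff transpose_def)
    have "E (z \<circ> transpose i (Suc ?j)) = E (z \<circ> transpose ?j (Suc ?j) \<circ> transpose i ?j)"
      unfolding t comp_assoc[symmetric] by (rule swap) simp
    also have "\<dots> = E (z \<circ> transpose ?j (Suc ?j))" by (rule Suc.IH)
    also have "\<dots> = E z" by (rule swap) simp
    finally show ?case by (simp only: add_Suc_right)
  qed
  have upd: "E (z(i := c)) = E z" if i: "i > 0" for i c z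
  proof -
    \<comment> \<open>A position beyond both \<open>i\<close> and \<open>N\<close>: the value
      \<open>c\<close> can be written there unnoticed, exchanged with the entry at \<open>i\<close>,
      and the old entry left behind at \<open>?m\<close> is again unnoticed.\<close>
    let ?m = "Suc (i + N)"
    let ?y = "z(?m := c)"
    have "E z = E ?y" by (rule supp) simp
    also have "\<dots> = E (?y \<circ> transpose i ?m)" using swaps[OF i] by simp
    also have "\<dots> = E (z(i := c))" by (rule supp) (auto simp: transpose_def)
    finally show ?thesis by simp
  qed
  \<comment> \<open>The coordinates are replaced one at a time; after \<open>N\<close> of them the
    argument agrees with \<open>y\<close> wherever \<open>E\<close> looks.\<close>
  have "E (\<lambda>i. if 1 \<le> i \<and> i \<le> k then y i else z i) = E z" for k
  proof (induction k)
    case (Suc k)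
    have "(\<lambda>i. if 1 \<le> i \<and> i \<le> Suc k then y i else z i) =
        (\<lambda>i. if 1 \<le> i \<and> i \<le> k then y i else z i)(Suc k := y (Suc k))"
      by (auto simp: fun_eq_iff)
    then show ?case using Suc upd[of "Suc k"] by simp
  next
    case 0
    show ?case by (rule supp) simp
  qed
  moreover have "E (\<lambda>i. if 1 \<le> i \<and> i \<le> N then y i else z i) = E y" by (rule supp) simp
  ultimately show ?thesis by metis
qed

lemma hprod_zeros: "(\<And>i t. (i, t) \<in> set L \<Longrightarrow> t = 0) \<Longrightarrow> hprod L g = g"
proof (induction L g rule: hprod.induct)
  case (2 i t L g)
  have "t = 0" using "2.prems"[of i t] by simp
  moreover have "hprod L (hfac i t g) = hfac i t g" by (rule "2.IH") (use "2.prems" in auto)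
  ultimately show ?case by (simp add: hfac_eq)
qed simp

lemma nil_coeff_origin: "nil_coeff (dream_factors n [] (\<lambda>_. 0)) w = (if w = id then 1 else 0)"
  unfolding nil_coeff_def
  by (subst hprod_zeros) (auto simp: dream_factors_def gblocks_def rows_def down_def)

text \<open>Stated for all \<open>xs\<close> and \<open>z\<close>, since the substitutions used in
  the proof change both.\<close>

lemma eval_at_schubert_C:
  assumes fam: "schubert_C_family C" and n: "n > 0" and w: "w \<in> BC n"
  shows "eval_at xs z (C w) = nil_coeff (dream_factors n xs z) w"
  using w
proof (induction "cox_length w" arbitrary: w xs z rule: less_induct)
  case less
  have winf: "w \<in> BC_inf" using less.prems by (rule BC_subset_BC_inf)
  note C = schubert_C_divdiff[OF fam winf]
  \<comment> \<open>By the induction hypothesis the correction terms on the two sides coincide: both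
    belong to w s_i if \<open>i\<close> is a descent and are 0 otherwise.\<close>
  have dd: "eval_at xs z (divdiff i (C w)) = nil_op i (nil_coeff (dream_factors n xs z)) w" for i xs z
  proof (cases "cox_length (w \<circ> sgen i) < cox_length w")
    case True
    then have "w \<circ> sgen i \<in> BC n"
      using BC_descent_less less.prems by (intro comp_in_BC sgen_in_BC) auto
    then show ?thesis using True winf less.hyps[OF True] by (simp add: C(1) nil_op_def)
  next
    case False
    then show ?thesis by (simp add: C(1) nil_op_def eval_at_def)
  qed
  define D where "D xs z = eval_at xs z (C w) - nil_coeff (dream_factors n xs z) w" for xs z
  have swap: "D xs (z \<circ> transpose i (Suc i)) = D xs z" if i: "i > 0" for xs z i
  proof (cases "i < n")
    case True
    then show ?thesis
      by (simp only: D_def eval_at_swap[OF C(2) i] nil_coeff_swap[OF i True] dd) simp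
  next
    \<comment> \<open>For \<open>i >= n\<close> neither side notices the exchange: the rows use only
      z_1, ..., z_{n-1}, and \<open>i\<close> is not a descent of \<open>w\<close>.\<close>
    case False
    then have "rows n 1 (z \<circ> transpose i (Suc i)) = rows n 1 z"
      by (intro rows_cong) (auto simp: transpose_def)
    then have "dream_factors n xs (z \<circ> transpose i (Suc i)) = dream_factors n xs z"
      by (simp only: dream_factors_def)
    moreover have "divdiff i (C w) = 0" using C(1) BC_descent_less[OF less.prems] False by auto
    ultimately show ?thesis using eval_at_swap[OF C(2) i, of xs z]
      by (simp add: D_def eval_at_def)
  qed
  have reflect: "D (xs @ [z 1]) (z(1 := - z 1)) = D xs z" for xs z
    by (simp only: D_def eval_at_reflect[OF C(2)] nil_coeff_reflect[OF n] dd) simp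
  obtain N where N: "\<And>xs y z. (\<And>i. 1 \<le> i \<Longrightarrow> i \<le> N \<Longrightarrow> y i = z i) \<Longrightarrow>
      eval_at xs y (C w) = eval_at xs z (C w)"
    using eval_at_finite_support[OF C(2)] by meson
  \<comment> \<open>The bound \<open>max N n\<close> covers the z-variables of \<open>C w\<close> as
    well as those of the rows.\<close>
  have const: "D xs y = D xs z" for xs y z
  proof (rule symmetric_finite_support_const[where E = "D xs" and N = "max N n"])
    show "D xs y = D xs z" if "\<And>i. 1 \<le> i \<Longrightarrow> i \<le> max N n \<Longrightarrow> y i = z i" for y z
    proof -
      have "rows n 1 y = rows n 1 z" by (rule rows_cong) (use that in auto)
      then show ?thesis using N[of y z xs] that by (simp add: D_def dream_factors_def)
    qed
  qed (rule swap)
  have "D xs z = D [] z" for xs z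
  proof (induction xs rule: rev_induct)
    case (snoc t xs)
    \<comment> \<open>As \<open>D\<close> does not depend on its second argument, (-t, t, t, ...)
      may be taken; it is the reflection of the constant sequence t, so \<open>reflect\<close>
      removes the entry \<open>t\<close> from the list.\<close>
    have "D (xs @ [t]) z = D (xs @ [t]) ((\<lambda>_. t)(1 := - t))" by (rule const)
    also have "\<dots> = D xs (\<lambda>_. t)" by (rule reflect)
    also have "\<dots> = D xs z" by (rule const)
    finally show ?case using snoc by simp
  qed simp
  also have "D [] z = D [] (\<lambda>_. 0)" for z by (rule const)
  also have "\<dots> = 0"
    by (simp add: D_def eval_at_origin[OF C(2)] schubert_C_constant_term[OF fam winf]
        nil_coeff_origin)
  finally show ?case by (simp add: D_def)
qed

section \<open>Pipe dreams\<close>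

text \<open>The coefficient of a word in the product of the factors \<open>1 + t s\<^sub>i\<close> over a free monoid.\<close>

fun word_coeff :: "(nat \<times> 'a::comm_ring_1) list \<Rightarrow> nat list \<Rightarrow> 'a" where
  "word_coeff [] a = (if a = [] then 1 else 0)"
| "word_coeff ((i, t) # L) a = word_coeff L a +
     (case a of [] \<Rightarrow> 0 | c # b \<Rightarrow> if c = i then t * word_coeff L b else 0)"

lemma word_coeff_append:
  "word_coeff (L @ M) a = (\<Sum>j\<le>length a. word_coeff L (take j a) * word_coeff M (drop j a))"
proof (induction L a rule: word_coeff.induct)
  case (1 a)
  have "(\<Sum>j\<le>length a. word_coeff [] (take j a) * word_coeff M (drop j a)) =
      (\<Sum>j\<in>{0}. word_coeff [] (take j a) * word_coeff M (drop j a))"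
    by (rule sum.mono_neutral_right) auto
  then show ?case by simp
next
  case (2 i t L a)
  show ?case
  proof (cases a)
    case Nil
    then show ?thesis using 2 by simp
  next
    case (Cons c b)
    have "(\<Sum>j\<le>length a. word_coeff ((i, t) # L) (take j a) * word_coeff M (drop j a)) =
        word_coeff L [] * word_coeff M a + (\<Sum>j\<le>length b. word_coeff L (c # take j b) *
          word_coeff M (drop j b)) +
        (if c = i then t * (\<Sum>j\<le>length b. word_coeff L (take j b) * word_coeff M (drop j b)) else 0)"
      unfolding Cons by (simp only: length_Cons sum.atMost_Suc_shift)
        (auto simp: sum.distrib distrib_right distrib_left sum_distrib_left mult_ac)
    also have "word_coeff L [] * word_coeff M a +
        (\<Sum>j\<le>length b. word_coeff L (c # take j b) * word_coeff M (drop j b)) =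
        (\<Sum>j\<le>length a. word_coeff L (take j a) * word_coeff M (drop j a))"
      unfolding Cons by (simp only: length_Cons sum.atMost_Suc_shift) simp
    finally show ?thesis using 2 Cons by simp
  qed
qed

lemma word_coeff_snoc:
  "word_coeff (L @ [(i, t)]) a = word_coeff L a +
    (if a \<noteq> [] \<and> last a = i then t * word_coeff L (butlast a) else 0)"
proof (induction L a rule: word_coeff.induct)
  case (1 a)
  then show ?case by (cases a) auto
next
  case (2 j s L a)
  show ?case
  proof (cases a)
    case (Cons c b)
    then show ?thesis using 2 by (cases "b = []") (auto simp: algebra_simps)
  qed (use 2 in simp)
qed

text \<open>In passing from free words to the nil-Coxeter algebra exactly the reduced words survive.
  In the induction, the words that use the last factor are the reduced words of w s_i followed by
  \<open>i\<close>.\<close>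

lemma nil_coeff_eq_sum_word_coeff:
  "w \<in> BC_inf \<Longrightarrow> nil_coeff L w = (\<Sum>a\<in>reduced_words w. word_coeff L a)"
proof (induction L arbitrary: w rule: rev_induct)
  case Nil
  have "(\<Sum>a\<in>reduced_words w. word_coeff [] a) = (if [] \<in> reduced_words w then 1 else 0 :: 'a)"
    using finite_reduced_words Nil by (auto simp: BC_inf_def)
  also have "[] \<in> reduced_words w \<longleftrightarrow> w = id" by (auto simp: reduced_words_def)
  finally show ?case by (simp add: nil_coeff_def)
next
  case (snoc p L)
  obtain i t where p: "p = (i, t)" by (cases p)
  let ?R = "{a \<in> reduced_words w. a \<noteq> [] \<and> last a = i}"
  have fin: "finite (reduced_words w)" using finite_reduced_words snoc.prems by (auto simp: BC_inf_def)
  have R: "?R = (if cox_length (w \<circ> sgen i) < cox_length w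
      then (\<lambda>a. a @ [i]) ` reduced_words (w \<circ> sgen i) else {})" (is "_ = ?R'")
  proof (intro set_eqI iffI)
    fix a assume "a \<in> ?R"
    then show "a \<in> ?R'"
      by (cases a rule: rev_cases) (auto simp: reduced_words_snoc)
  next
    fix a assume "a \<in> ?R'"
    then show "a \<in> ?R" using snoc.prems by (auto simp: reduced_words_snoc split: if_splits)
  qed
  have "(\<Sum>a\<in>reduced_words w. word_coeff (L @ [p]) a) = (\<Sum>a\<in>reduced_words w. word_coeff L a) +
      (\<Sum>a\<in>?R. t * word_coeff L (butlast a))"
    unfolding p word_coeff_snoc sum.distrib using fin
    by (simp add: sum.inter_filter)
  also have "(\<Sum>a\<in>?R. t * word_coeff L (butlast a)) = t * nil_op i (nil_coeff L) w"
  proof -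
    have "nil_coeff L (w \<circ> sgen i) = (\<Sum>a\<in>reduced_words (w \<circ> sgen i). word_coeff L a)"
      by (rule snoc.IH) (simp only: BC_inf_comp_sgen snoc.prems)
    then show ?thesis unfolding R using snoc.prems
      by (simp add: nil_op_def sum.reindex inj_on_def sum_distrib_left)
  qed
  finally show ?case using snoc by (simp add: p nil_coeff_snoc)
qed

definition tile_weight :: "box \<Rightarrow> tile \<Rightarrow> polyQ" where
  "tile_weight b t = (if significant t then Var (box_var b) else 1)"

text \<open>Each box has two tiles, chosen independently: one contributes 1, the other its letter
  times its variable. So a box contributes a factor 1 + t s_i; in a box of index 0 the faucet plays
  the part of the cross.\<close>

lemma sum_fillings:
  assumes "distinct bs"
  shows "(\<Sum>D\<in>PiE (set bs) allowed_tiles.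
      if concat (map (\<lambda>b. letters (D b) (box_index b)) bs) = a
      then \<Prod>b\<in>set bs. tile_weight b (D b) else 0) =
    word_coeff (map (\<lambda>b. (box_index b, Var (box_var b))) bs) a"
  using assms
proof (induction bs arbitrary: a)
  case Nil
  then show ?case by simp
next
  case (Cons c bs)
  let ?w = "\<lambda>bs D. concat (map (\<lambda>b. letters (D b) (box_index b)) bs)"
  let ?m = "\<lambda>bs D. \<Prod>b\<in>set bs. tile_weight b (D b)"
  let ?F = "\<lambda>a. \<Sum>D\<in>PiE (set bs) allowed_tiles. if ?w bs D = a then ?m bs D else 0"
  have c: "c \<notin> set bs" using Cons.prems by simp
  have w: "?w (c # bs) (D(c := y)) = letters y (box_index c) @ ?w bs D" for D y
  proof -
    have "map (\<lambda>b. letters ((D(c := y)) b) (box_index b)) bs = map (\<lambda>b. letters (D b) (box_index b)) bs"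
      using c by (intro map_cong) auto
    then show ?thesis by (simp only: list.map concat.simps fun_upd_same)
  qed
  have m: "?m (c # bs) (D(c := y)) = tile_weight c y * ?m bs D" for D y
  proof -
    have "?m bs (D(c := y)) = ?m bs D" using c by (intro prod.cong) auto
    then show ?thesis using c by simp
  qed
  have "(\<Sum>D\<in>PiE (set (c # bs)) allowed_tiles. if ?w (c # bs) D = a then ?m (c # bs) D else 0) =
      (\<Sum>(y, D)\<in>allowed_tiles c \<times> PiE (set bs) allowed_tiles.
        if letters y (box_index c) @ ?w bs D = a then tile_weight c y * ?m bs D else 0)"
    unfolding list.set PiE_insert_eq
    by (subst sum.reindex[OF inj_combinator[OF c]], intro sum.cong refl)
      (simp only: o_apply case_prod_unfold w[unfolded list.set] m[unfolded list.set])
  also have "\<dots> = (\<Sum>y\<in>allowed_tiles c. \<Sum>D\<in>PiE (set bs) allowed_tiles.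
        if letters y (box_index c) @ ?w bs D = a then tile_weight c y * ?m bs D else 0)"
    by (rule sum.cartesian_product[symmetric])
  also have "\<dots> = ?F a + (case a of [] \<Rightarrow> 0 | d # b \<Rightarrow>
      if d = box_index c then Var (box_var c) * ?F b else 0)"
  proof -
    have "(\<Sum>D\<in>PiE (set bs) allowed_tiles.
        if box_index c # ?w bs D = a then Var (box_var c) * ?m bs D else 0) =
      (case a of [] \<Rightarrow> 0 | d # b \<Rightarrow> if d = box_index c then Var (box_var c) * ?F b else 0)"
      by (cases a) (auto simp: sum_distrib_left intro!: sum.cong)
    moreover have "tile_weight c SingleElbow = 1" "tile_weight c FaucetElbow = Var (box_var c)"
      "tile_weight c DoubleElbow = 1" "tile_weight c Cross = Var (box_var c)"
      by (simp_all add: tile_weight_def significant_def)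
    ultimately show ?thesis
      by (cases "box_index c = 0") (simp_all add: allowed_tiles_def cong: if_cong)
  qed
  also have "?F = word_coeff (map (\<lambda>b. (box_index b, Var (box_var b))) bs)"
    by (rule ext, rule Cons.IH) (use Cons.prems in simp)
  finally show ?case by (simp only: list.map word_coeff.simps)
qed

lemma distinct_reading_order: "distinct (reading_order k n)"
proof -
  have c: "distinct (concat (map f xs))"
    if "distinct xs" "\<And>x. x \<in> set xs \<Longrightarrow> distinct (f x)"
      "\<And>x y. x \<in> set xs \<Longrightarrow> y \<in> set xs \<Longrightarrow> x \<noteq> y \<Longrightarrow> set (f x) \<inter> set (f y) = {}"
    for f :: "nat \<Rightarrow> box list" and xs
    using that by (induction xs) auto
  show ?thesis unfolding reading_order_def
    by (auto intro!: c simp: distinct_map inj_on_def)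
qed

lemma set_reading_order: "set (reading_order k n) = base k n"
  unfolding reading_order_def base_def by (force simp: image_iff)

lemma finite_pipe_dreams: "finite (pipe_dreams k n)"
  unfolding pipe_dreams_def set_reading_order[symmetric]
  by (intro finite_PiE) (auto simp: allowed_tiles_def)

text \<open>The boxes of staircase row \<open>i\<close> have indices \<open>i\<close>, ...,
  \<open>n - 1\<close>, so reading from right to left gives A_i(z_i); each \<Gamma>-block gives
  B(x_m).\<close>

lemma map_reading_order:
  "map (\<lambda>b. (box_index b, Var (box_var b))) (reading_order k n) =
    dream_factors n (map (\<lambda>m. Var (X m)) (rev [1..<k + 1])) (\<lambda>i. Var (Z i))"
proof -
  have row: "map (\<lambda>b. (box_index b, Var (box_var b))) (map (Stair i) (rev [1..<n - i + 1])) =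
      down n i (Var (Z i))" if "i \<in> set [1..<n]" for i
  proof -
    have "[i..<n] = map (\<lambda>j. i + j - 1) [1..<n - i + 1]"
      by (rule nth_equalityI) (use that in \<open>auto simp del: upt_Suc\<close>)
    then show ?thesis unfolding down_def by (simp add: rev_map comp_def del: upt_Suc)
  qed
  have "map (\<lambda>b. (box_index b, Var (box_var b)))
      (concat (map (\<lambda>i. map (Stair i) (rev [1..<n - i + 1])) [1..<n])) =
      rows n 1 (\<lambda>i. Var (Z i))"
    unfolding rows_def map_concat map_map o_def using row
    by (intro arg_cong[of _ _ concat] map_cong refl) (simp only: map_map o_def)
  then show ?thesis
    by (simp add: reading_order_def dream_factors_def gblocks_def gamma_def down_def up_def
        map_concat comp_def del: upt_Suc)
qed

lemma sum_PD:
  assumes "w \<in> BC n"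
  shows "(\<Sum>D\<in>PD k n w. pd_monom k n D) =
    nil_coeff (dream_factors n (map (\<lambda>m. Var (X m)) (rev [1..<k + 1])) (\<lambda>i. Var (Z i))) w"
proof -
  have fin: "finite (reduced_words w)" by (rule finite_reduced_words[OF assms])
  have base: "finite (base k n)" unfolding set_reading_order[symmetric] by simp
  have m: "pd_monom k n D = (\<Prod>b\<in>base k n. tile_weight b (D b))" for D
    unfolding pd_monom_def tile_weight_def by (rule prod.inter_filter[OF base])
  have "(\<Sum>D\<in>PD k n w. pd_monom k n D) =
      (\<Sum>D\<in>pipe_dreams k n. if pd_word k n D \<in> reduced_words w then pd_monom k n D else 0)"
    unfolding PD_def by (rule sum.inter_filter[OF finite_pipe_dreams])
  also have "\<dots> = (\<Sum>D\<in>pipe_dreams k n. \<Sum>a\<in>reduced_words w.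
      if pd_word k n D = a then pd_monom k n D else 0)"
    using fin by simp
  also have "\<dots> = (\<Sum>a\<in>reduced_words w. \<Sum>D\<in>pipe_dreams k n.
      if pd_word k n D = a then pd_monom k n D else 0)"
    by (rule sum.swap)
  also have "\<dots> = (\<Sum>a\<in>reduced_words w.
      word_coeff (map (\<lambda>b. (box_index b, Var (box_var b))) (reading_order k n)) a)"
    unfolding sum_fillings[OF distinct_reading_order, symmetric]
    by (simp only: pipe_dreams_def pd_word_def m set_reading_order)
  finally show ?thesis
    by (simp only: map_reading_order nil_coeff_eq_sum_word_coeff[OF BC_subset_BC_inf[OF assms]])
qed

section \<open>Admissible monomials\<close>

lemma lookup_exponent: "Poly_Mapping.lookup (exponent js) i = count_list js i"
  unfolding exponent_def by (induction js) (auto simp: lookup_add lookup_single when_def)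

lemma keys_exponent: "Poly_Mapping.keys (exponent js) = set js"
  by (auto simp: in_keys_iff lookup_exponent count_list_0_iff)

text \<open>A sorted list is determined by its multiplicities. Hence sums over admissible monomials
  become sums over admissible sequences.\<close>

lemma exponent_inj:
  assumes "sorted js" "sorted js'" "exponent js = exponent js'" shows "js = js'"
proof -
  have "mset js = mset js'"
    by (rule multiset_eqI) (metis assms(3) count_mset lookup_exponent)
  then show ?thesis using assms(1,2) by (metis properties_for_sort)
qed

lemma prod_exponent:
  fixes f :: "nat \<Rightarrow> 'a::comm_monoid_mult"
  shows "(\<Prod>i\<in>Poly_Mapping.keys (exponent js). f i ^ Poly_Mapping.lookup (exponent js) i) =
    (\<Prod>j\<leftarrow>js. f j)"
proof -
  have "(\<Prod>i\<in>S. f i ^ count_list js i) = (\<Prod>j\<leftarrow>js. f j)" if "finite S" "set js \<subseteq> S" for S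
    using that(2)
  proof (induction js)
    case (Cons x js)
    have "(\<Prod>i\<in>S. f i ^ count_list (x # js) i) =
        (\<Prod>i\<in>S. (if i = x then f i else 1) * f i ^ count_list js i)"
      by (intro prod.cong) auto
    then show ?case using Cons that(1) by (simp add: prod.distrib)
  qed simp
  then show ?thesis by (simp add: keys_exponent lookup_exponent)
qed

text \<open>The factors have distinct, decreasing indices, so a word is obtained at most once,
  namely by choosing its letters from a strictly decreasing run.\<close>

lemma word_coeff_down:
  "word_coeff (down n i t) a = (if sorted_wrt (>) a \<and> set a \<subseteq> {i..<n} then t ^ length a else 0)"
proof (induction n arbitrary: a)
  case 0
  then show ?case by (cases a) (auto simp: down_def)
next
  case (Suc n)
  show ?case
  proof (cases "i \<le> n")
    case False
    then show ?thesis by (cases a) (auto simp: down_def)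
  next
    case True
    have d: "down (Suc n) i t = (n, t) # down n i t" using True by (simp add: down_def)
    show ?thesis
    proof (cases a)
      case (Cons c b)
      show ?thesis
      proof (cases "c = n")
        case True
        then have "sorted_wrt (>) a \<and> set a \<subseteq> {i..<Suc n} \<longleftrightarrow> sorted_wrt (>) b \<and> set b \<subseteq> {i..<n}"
          "\<not> set a \<subseteq> {i..<n}"
          using Cons \<open>i \<le> n\<close> by auto
        then show ?thesis using True Suc.IH[of a] Suc.IH[of b] unfolding d Cons by simp
      next
        case False
        then have *: "sorted_wrt (>) a \<and> set a \<subseteq> {i..<Suc n} \<longleftrightarrow> sorted_wrt (>) a \<and> set a \<subseteq> {i..<n}"
        proof (intro conj_cong refl iffI subsetI)
          fix x assume x: "sorted_wrt (>) a" "set a \<subseteq> {i..<Suc n}" "x \<in> set a"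
          then have "c < n" "x \<le> c" "i \<le> x" using False Cons by auto
          then show "x \<in> {i..<n}" by simp
        qed auto
        have "word_coeff (down (Suc n) i t) a = word_coeff (down n i t) a"
          using False unfolding d Cons by simp
        then show ?thesis unfolding Suc.IH * .
      qed
    qed (use Suc.IH[of a] in \<open>simp add: d\<close>)
  qed
qed

lemma up_unfold: "i < n \<Longrightarrow> up n i t = (i, t) # up n (Suc i) t"
  by (simp add: up_def upt_conv_Cons)

lemma word_coeff_up:
  "word_coeff (up n i t) a = (if sorted_wrt (<) a \<and> set a \<subseteq> {i..<n} then t ^ length a else 0)"
proof (induction "n - i" arbitrary: i a)
  case 0
  then show ?case by (cases a) (auto simp: up_def)
next
  case (Suc m)
  have d: "up n i t = (i, t) # up n (Suc i) t" using Suc.hyps(2) by (simp add: up_unfold)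
  have IH: "word_coeff (up n (Suc i) t) a =
      (if sorted_wrt (<) a \<and> set a \<subseteq> {Suc i..<n} then t ^ length a else 0)" for a
    by (rule Suc.hyps(1)) (use Suc.hyps(2) in simp)
  show ?case
  proof (cases a)
    case (Cons c b)
    show ?thesis
    proof (cases "c = i")
      case True
      then have "sorted_wrt (<) a \<and> set a \<subseteq> {i..<n} \<longleftrightarrow> sorted_wrt (<) b \<and> set b \<subseteq> {Suc i..<n}"
        "\<not> set a \<subseteq> {Suc i..<n}"
        using Cons Suc.hyps(2) by (auto simp: Suc_le_eq)
      then show ?thesis using True IH[of a] IH[of b] unfolding d Cons by simp
    next
      case False
      then have *: "sorted_wrt (<) a \<and> set a \<subseteq> {i..<n} \<longleftrightarrow> sorted_wrt (<) a \<and> set a \<subseteq> {Suc i..<n}"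
      proof (intro conj_cong refl iffI subsetI)
        fix x assume x: "sorted_wrt (<) a" "set a \<subseteq> {i..<n}" "x \<in> set a"
        then have "i < c" "c \<le> x" "x < n" using False Cons by auto
        then show "x \<in> {Suc i..<n}" by simp
      qed auto
      have "word_coeff (up n i t) a = word_coeff (up n (Suc i) t) a"
        using False unfolding d Cons by simp
      then show ?thesis unfolding IH * .
    qed
  next
    case Nil
    then show ?thesis using IH[of "[]"] unfolding d by simp
  qed
qed

section \<open>Peaks and the words of a \<Gamma>-block\<close>

lemma peak_set_Cons:
  "peak_set (c # d # e # b) = {} \<longleftrightarrow> \<not> (c < d \<and> e < d) \<and> peak_set (d # e # b) = {}"
proof
  assume *: "peak_set (c # d # e # b) = {}"
  have "\<not> (c < d \<and> e < d)"
  proof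
    assume "c < d \<and> e < d"
    then have "1 \<in> peak_set (c # d # e # b)" by (simp add: peak_set_def)
    with * show False by blast
  qed
  moreover have "peak_set (d # e # b) = {}"
  proof (rule ccontr)
    assume "peak_set (d # e # b) \<noteq> {}"
    then obtain i where "i \<in> peak_set (d # e # b)" by blast
    then have "Suc i \<in> peak_set (c # d # e # b)"
      by (cases i) (auto simp: peak_set_def)
    with * show False by blast
  qed
  ultimately show "\<not> (c < d \<and> e < d) \<and> peak_set (d # e # b) = {}" by blast
next
  assume *: "\<not> (c < d \<and> e < d) \<and> peak_set (d # e # b) = {}"
  show "peak_set (c # d # e # b) = {}"
  proof (rule ccontr)
    assume "peak_set (c # d # e # b) \<noteq> {}"
    then obtain i where i: "i \<in> peak_set (c # d # e # b)" by blast
    then obtain j where j: "i = Suc j" by (cases i) (auto simp: peak_set_def)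
    show False
    proof (cases j)
      case 0
      then show ?thesis using i j * by (simp add: peak_set_def)
    next
      case (Suc l)
      then have "j \<in> peak_set (d # e # b)" using i j by (auto simp: peak_set_def)
      then show ?thesis using * by blast
    qed
  qed
qed

lemma peak_set_short: "length a \<le> 2 \<Longrightarrow> peak_set a = {}"
  by (auto simp: peak_set_def)

text \<open>As neighbouring letters differ, the first descent after an ascent would create a
  peak.\<close>

lemma peakless_ascending:
  "c < d \<Longrightarrow> distinct_adj (c # d # b) \<Longrightarrow> peak_set (c # d # b) = {} \<longleftrightarrow> sorted_wrt (<) (d # b)"
proof (induction b arbitrary: c d)
  case Nil
  then show ?case by (simp add: peak_set_short)
next
  case (Cons e b)
  show ?case
  proof (cases "d < e")
    case True
    have "sorted_wrt (<) (d # e # b) \<longleftrightarrow> sorted_wrt (<) (e # b)" using True by auto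
    then show ?thesis using Cons True by (simp add: peak_set_Cons)
  next
    case False
    then have "e < d" using Cons.prems by simp
    then show ?thesis using Cons.prems by (auto simp: peak_set_Cons)
  qed
qed

text \<open>A nonempty peakless word has exactly two splittings into a decreasing and an increasing part,
  since its minimum can belong to either part: this is the origin of the powers of \<open>2\<close>.\<close>

definition valley_splits :: "nat list \<Rightarrow> nat set" where
  "valley_splits a = {j. j \<le> length a \<and> sorted_wrt (>) (take j a) \<and> sorted_wrt (<) (drop j a)}"

text \<open>If the word starts with a descent, its splits are those of the tail shifted by one. If
  it starts with an ascent, the cut lies directly before or after the first letter, and everything
  that follows must ascend.\<close>

lemma card_valley_splits:
  "distinct_adj a \<Longrightarrow>
    card (valley_splits a) = (if peak_set a = {} then if a = [] then 1 else 2 else 0)"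
proof (induction a rule: induct_list012)
  case 1
  have "valley_splits [] = {0}" by (auto simp: valley_splits_def)
  then show ?case by (simp add: peak_set_short)
next
  case (2 c)
  have "valley_splits [c] = {0, 1}" by (auto simp: valley_splits_def le_Suc_eq)
  then show ?case by (simp add: peak_set_short)
next
  case (3 c d b)
  show ?case
  proof (cases "c > d")
    case True
    have "valley_splits (c # d # b) = Suc ` valley_splits (d # b)"
    proof (intro set_eqI iffI)
      fix j assume j: "j \<in> valley_splits (c # d # b)"
      then obtain i where "j = Suc i" using True by (cases j) (auto simp: valley_splits_def)
      then show "j \<in> Suc ` valley_splits (d # b)" using j by (auto simp: valley_splits_def)
    next
      fix j assume "j \<in> Suc ` valley_splits (d # b)"
      then obtain i where i: "j = Suc i" "i \<in> valley_splits (d # b)" by blast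
      then show "j \<in> valley_splits (c # d # b)"
        using True by (cases i) (auto simp: valley_splits_def)
    qed
    moreover have "peak_set (c # d # b) = {} \<longleftrightarrow> peak_set (d # b) = {}"
      using True by (cases b) (simp_all add: peak_set_Cons peak_set_short)
    ultimately show ?thesis using 3 by (simp add: card_image)
  next
    case False
    then have cd: "c < d" using "3.prems" by simp
    have "valley_splits (c # d # b) = (if sorted_wrt (<) (d # b) then {0, 1} else {})"
    proof (intro set_eqI)
      fix j
      consider "j = 0" | "j = 1" | i where "j = Suc (Suc i)" by (cases j; cases "j - 1") auto
      then show "j \<in> valley_splits (c # d # b) \<longleftrightarrow>
          j \<in> (if sorted_wrt (<) (d # b) then {0, 1} else {})"
        by cases (use cd in \<open>auto simp: valley_splits_def\<close>)
    qed
    then show ?thesis using peakless_ascending[OF cd "3.prems"] by simp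
  qed
qed

text \<open>Splitting the word between the two halves of B(t) leaves a decreasing prefix and an
  increasing suffix, so the coefficient counts valley splits.\<close>

lemma word_coeff_gamma:
  assumes "distinct_adj a" "set a \<subseteq> {..<n}"
  shows "word_coeff (gamma n t) a =
    (if peak_set a = {} then if a = [] then 1 else 2 * t ^ length a else 0)"
proof -
  have "word_coeff (gamma n t) a =
      (\<Sum>j\<le>length a. if j \<in> valley_splits a then t ^ length a else 0)"
    unfolding gamma_def word_coeff_append
  proof (rule sum.cong)
    fix j assume "j \<in> {..length a}"
    then have j: "j \<le> length a" by simp
    have "set (take j a) \<subseteq> {0..<n}" "set (drop j a) \<subseteq> {0..<n}"
      using assms(2) set_take_subset[of j a] set_drop_subset[of j a] by auto
    then show "word_coeff (down n 0 t) (take j a) * word_coeff (up n 0 t) (drop j a) =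
        (if j \<in> valley_splits a then t ^ length a else 0)"
      using j by (simp add: word_coeff_down word_coeff_up valley_splits_def power_add[symmetric])
  qed simp
  also have "\<dots> = (\<Sum>j\<in>{j \<in> {..length a}. j \<in> valley_splits a}. t ^ length a)"
    by (rule sum.inter_filter[symmetric]) simp
  also have "{j \<in> {..length a}. j \<in> valley_splits a} = valley_splits a"
    by (auto simp: valley_splits_def)
  finally show ?thesis using card_valley_splits[OF assms(1)] by simp
qed

section \<open>Admissible sequences cut after their leading block\<close>

lemma split_leading_block:
  assumes "sorted_wrt R js" "\<And>x. x \<in> set js \<Longrightarrow> R x K \<Longrightarrow> x = K"
  shows "\<exists>j js'. js = replicate j K @ js' \<and> K \<notin> set js'"
  using assms
proof (induction js)
  case (Cons x js)
  show ?case
  proof (cases "x = K")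
    case True
    obtain j js' where "js = replicate j K @ js'" "K \<notin> set js'" using Cons by auto
    then have "x # js = replicate (Suc j) K @ js'" "K \<notin> set js'" using True by auto
    then show ?thesis by blast
  next
    case False
    then have "K \<notin> set (x # js)" using Cons.prems by auto
    then show ?thesis by (intro exI[of _ 0] exI[of _ "x # js"]) simp
  qed
qed simp

lemma replicate_append_inject:
  assumes "replicate i K @ xs = replicate j K @ ys" "K \<notin> set xs" "K \<notin> set ys"
  shows "i = j \<and> xs = ys"
proof -
  have "takeWhile (\<lambda>x. x = K) (replicate i K @ xs) = replicate i K"
    if "K \<notin> set xs" for i xs
    using that by (cases xs) (auto simp: takeWhile_append)
  then have "length (replicate i K) = length (replicate j K)" using assms by metis
  then show ?thesis using assms(1) by simp
qed

text \<open>Since \<open>K\<close> does not recur after the leading block, a sequence is determined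
  by the block length and the rest. With \<open>Q\<close> the condition on the letters under the
  block, the sum takes the convolution form of \<open>word_coeff_append\<close>.\<close>

lemma sum_leading_block:
  assumes K: "\<And>b js. js \<in> J b \<Longrightarrow> K \<notin> set js" and fin: "\<And>b. finite (J b)"
  assumes S: "S = {replicate j K @ js | j js. j \<le> length a \<and> Q (take j a) \<and> js \<in> J (drop j a)}"
  shows "(\<Sum>js\<in>S. F js) =
      (\<Sum>j\<le>length a. if Q (take j a) then \<Sum>js\<in>J (drop j a). F (replicate j K @ js) else 0)"
proof -
  let ?I = "{j \<in> {..length a}. Q (take j a)}"
  have S': "S = (\<lambda>(j, js). replicate j K @ js) ` (SIGMA j:?I. J (drop j a))"
    unfolding S by (force simp: image_iff)
  have "inj_on (\<lambda>(j, js). replicate j K @ js) (SIGMA j:?I. J (drop j a))"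
    by (rule inj_onI) (auto dest!: replicate_append_inject K)
  then have "(\<Sum>js\<in>S. F js) = (\<Sum>(j, js)\<in>(SIGMA j:?I. J (drop j a)). F (replicate j K @ js))"
    unfolding S' by (subst sum.reindex) (auto simp: case_prod_unfold)
  also have "\<dots> = (\<Sum>j\<in>?I. \<Sum>js\<in>J (drop j a). F (replicate j K @ js))"
    by (rule sum.Sigma[symmetric]) (use fin in auto)
  also have "\<dots> = (\<Sum>j\<le>length a. if Q (take j a)
      then \<Sum>js\<in>J (drop j a). F (replicate j K @ js) else 0)"
    by (rule sum.inter_filter) simp
  finally show "(\<Sum>js\<in>S. F js) = \<dots>" .
qed

text \<open>The bound \<open>k\<close> expresses truncation; it is lowered by one whenever a
  \<Gamma>-block is split off.\<close>

definition bounded_x_admissible :: "nat \<Rightarrow> nat list \<Rightarrow> nat list set" where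
  "bounded_x_admissible k a = {js. x_admissible a js \<and> (\<forall>j\<in>set js. j \<le> k)}"

definition bounded_z_admissible :: "nat \<Rightarrow> nat list \<Rightarrow> nat list set" where
  "bounded_z_admissible i b = {js. z_admissible b js \<and> (\<forall>j\<in>set js. i \<le> j)}"

lemma finite_bounded_x_admissible: "finite (bounded_x_admissible k a)"
proof (rule finite_subset)
  show "bounded_x_admissible k a \<subseteq> {js. set js \<subseteq> {..k} \<and> length js = length a}"
    by (auto simp: bounded_x_admissible_def x_admissible_def)
qed (simp add: finite_lists_length_eq)

lemma finite_bounded_z_admissible: "finite (bounded_z_admissible i b)"
proof (rule finite_subset)
  show "bounded_z_admissible i b \<subseteq> {js. set js \<subseteq> {..Max (set b)} \<and> length js = length b}"
  proof (intro subsetI CollectI conjI)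
    fix js assume js: "js \<in> bounded_z_admissible i b"
    then show len: "length js = length b" by (simp add: bounded_z_admissible_def z_admissible_def)
    fix j assume "j \<in> set js"
    then obtain l where l: "l < length b" "j = js ! l" using len by (metis in_set_conv_nth)
    then have "j \<le> b ! l" using js by (simp add: bounded_z_admissible_def z_admissible_def)
    also have "\<dots> \<le> Max (set b)" using l by simp
    finally show "j \<in> {..Max (set b)}" by simp
  qed
qed (simp add: finite_lists_length_eq)

lemma sorted_wrt_replicate: "R x x \<Longrightarrow> sorted_wrt R (replicate n x)"
  by (induction n) auto

text \<open>Three equal consecutive entries lie entirely in the block or entirely in the rest,
  because all later entries are smaller than \<open>K\<close>. So the peak condition separates, and
  on the block it forbids every peak.\<close>

lemma x_admissible_block:
  assumes j: "j \<le> length a" and js: "\<And>x. x \<in> set js \<Longrightarrow> x < K" and K: "K \<ge> 1"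
  shows "x_admissible a (replicate j K @ js) \<longleftrightarrow>
    peak_set (take j a) = {} \<and> x_admissible (drop j a) js"
proof (cases "length js = length a - j")
  case False
  then show ?thesis using j by (auto simp: x_admissible_def)
next
  case len: True
  let ?l = "replicate j K @ js"
  let ?c = "\<lambda>a js i. 0 < i \<and> i + 1 < length a \<and> js ! (i - 1) = js ! i \<and> js ! i = js ! (i + 1)"
  have "(\<forall>i. ?c a ?l i \<longrightarrow> i \<notin> peak_set a) \<longleftrightarrow>
      peak_set (take j a) = {} \<and> (\<forall>i. ?c (drop j a) js i \<longrightarrow> i \<notin> peak_set (drop j a))"
    (is "?L \<longleftrightarrow> ?R1 \<and> ?R2")
  proof (intro iffI conjI)
    assume L: ?L
    show ?R1
    proof (rule ccontr)
      assume "\<not> ?R1"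
      then obtain i where i: "i \<in> peak_set (take j a)" by blast
      then have "?c a ?l i" "i \<in> peak_set a" using j by (auto simp: peak_set_def nth_append)
      with L show False by blast
    qed
    show ?R2
    proof (intro allI impI notI)
      fix i assume i: "?c (drop j a) js i" "i \<in> peak_set (drop j a)"
      then have "?c a ?l (i + j)" using j by (auto simp: nth_append)
      moreover have "i + j \<in> peak_set a" using i(2) j
        by (auto simp: peak_set_def add.commute)
      ultimately show False using L by blast
    qed
  next
    assume R: "?R1 \<and> ?R2"
    show ?L
    proof (intro allI impI notI)
      fix i assume i: "?c a ?l i" "i \<in> peak_set a"
      consider "i + 1 < j" | "i + 1 \<ge> j" "i - 1 < j" | "i - 1 \<ge> j" by linarith
      then show False
      proof cases
        case 1
        then have "i \<in> peak_set (take j a)" using i by (auto simp: peak_set_def)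
        then show False using R by blast
      next
        case 2
        then have "?l ! (i + 1) = js ! (i + 1 - j)" "?l ! (i - 1) = K"
          by (auto simp: nth_append)
        moreover have "js ! (i + 1 - j) < K" using 2 i(1) len by (intro js nth_mem) auto
        ultimately show False using i(1) by auto
      next
        case 3
        have "i - j \<in> peak_set (drop j a) \<and> ?c (drop j a) js (i - j)"
          if ij: "i - 1 \<ge> j" "i > 0"
        proof -
          obtain d where d: "i = Suc (j + d)" using ij by (metis Suc_pred' le_Suc_ex)
          show ?thesis using i unfolding d by (auto simp: peak_set_def nth_append)
        qed
        then show False using R 3 i(1) by blast
      qed
    qed
  qed
  moreover have "sorted_wrt (\<ge>) ?l \<longleftrightarrow> sorted_wrt (\<ge>) js"
    using js by (auto simp: sorted_wrt_append sorted_wrt_replicate less_imp_le)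
  ultimately show ?thesis using len j K by (auto simp: x_admissible_def)
qed

lemma bounded_x_admissible_Suc:
  "bounded_x_admissible (Suc k) a = {replicate j (Suc k) @ js | j js.
    j \<le> length a \<and> peak_set (take j a) = {} \<and> js \<in> bounded_x_admissible k (drop j a)}"
proof (intro set_eqI iffI)
  fix l assume l: "l \<in> bounded_x_admissible (Suc k) a"
  then have "sorted_wrt (\<ge>) l" "\<And>x. x \<in> set l \<Longrightarrow> x \<ge> Suc k \<Longrightarrow> x = Suc k"
    by (auto simp: bounded_x_admissible_def x_admissible_def le_antisym)
  then obtain j js where js: "l = replicate j (Suc k) @ js" "Suc k \<notin> set js"
    using split_leading_block[of "(\<ge>)" l "Suc k"] by blast
  have lt: "x < Suc k" if "x \<in> set js" for x
    using that js l by (auto simp: bounded_x_admissible_def le_less)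
  have "j \<le> length a" using l js by (auto simp: bounded_x_admissible_def x_admissible_def)
  then show "l \<in> {replicate j (Suc k) @ js | j js.
      j \<le> length a \<and> peak_set (take j a) = {} \<and> js \<in> bounded_x_admissible k (drop j a)}"
    using l lt x_admissible_block[OF _ lt, of j a] js(1)
    unfolding bounded_x_admissible_def by (auto simp: less_Suc_eq_le intro!: exI[of _ j] exI[of _ js])
next
  fix l assume "l \<in> {replicate j (Suc k) @ js | j js.
      j \<le> length a \<and> peak_set (take j a) = {} \<and> js \<in> bounded_x_admissible k (drop j a)}"
  then obtain j js where l: "l = replicate j (Suc k) @ js" "j \<le> length a"
    "peak_set (take j a) = {}" "js \<in> bounded_x_admissible k (drop j a)" by blast
  then show "l \<in> bounded_x_admissible (Suc k) a"
    using x_admissible_block[OF l(2), of js "Suc k"]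
    unfolding bounded_x_admissible_def by (auto simp: less_Suc_eq_le)
qed

lemma distinct_adj_take_drop:
  assumes "distinct_adj a" shows "distinct_adj (take j a)" "distinct_adj (drop j a)"
  using assms distinct_adj_appendD1[of "take j a" "drop j a"]
    distinct_adj_appendD2[of "take j a" "drop j a"] by simp_all

text \<open>Induction on the number of variables, splitting off the largest. Every nonempty block of
  equal indices adds one factor 2, as does a nonempty peakless word in B(t).\<close>

lemma sum_bounded_x_admissible:
  assumes "distinct_adj a" "set a \<subseteq> {..<n}"
  shows "(\<Sum>js\<in>bounded_x_admissible k a. 2 ^ card (set js) * (\<Prod>j\<leftarrow>js. f j :: 'a::comm_ring_1)) =
    word_coeff (gblocks n (map f (rev [1..<k + 1]))) a"
  using assms
proof (induction k arbitrary: a)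
  case 0
  have "bounded_x_admissible 0 a = (if a = [] then {[]} else {})"
  proof (intro set_eqI)
    fix js
    have "js \<in> bounded_x_admissible 0 a \<longleftrightarrow> js = [] \<and> a = []"
      by (cases js) (auto simp: bounded_x_admissible_def x_admissible_def)
    then show "js \<in> bounded_x_admissible 0 a \<longleftrightarrow> js \<in> (if a = [] then {[]} else {})" by simp
  qed
  then show ?case by (simp add: gblocks_def)
next
  case (Suc k)
  let ?F = "\<lambda>js. 2 ^ card (set js) * (\<Prod>j\<leftarrow>js. f j)"
  let ?g = "\<lambda>k. gblocks n (map f (rev [1..<k + 1]))"
  have K: "Suc k \<notin> set js" if "js \<in> bounded_x_admissible k b" for js b
    using that by (auto simp: bounded_x_admissible_def)
  have "(\<Sum>js\<in>bounded_x_admissible (Suc k) a. ?F js) = (\<Sum>j\<le>length a.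
      if peak_set (take j a) = {}
      then \<Sum>js\<in>bounded_x_admissible k (drop j a). ?F (replicate j (Suc k) @ js) else 0)"
    by (rule sum_leading_block[OF K finite_bounded_x_admissible bounded_x_admissible_Suc])
  also have "\<dots> = (\<Sum>j\<le>length a. word_coeff (gamma n (f (Suc k))) (take j a) *
      word_coeff (?g k) (drop j a))"
  proof (rule sum.cong)
    fix j assume "j \<in> {..length a}"
    then have j: "j \<le> length a" by simp
    have "?F (replicate j (Suc k) @ js) = (if j = 0 then 1 else 2 * f (Suc k) ^ j) * ?F js"
      if "js \<in> bounded_x_admissible k (drop j a)" for js
    proof -
      have "set (replicate j (Suc k) @ js) = (if j = 0 then set js else insert (Suc k) (set js))"
        by auto
      then show ?thesis using K[OF that] by (simp only: map_append prod_list.append)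
          (simp add: mult_ac)
    qed
    then have "(\<Sum>js\<in>bounded_x_admissible k (drop j a). ?F (replicate j (Suc k) @ js)) =
        (if j = 0 then 1 else 2 * f (Suc k) ^ j) *
          (\<Sum>js\<in>bounded_x_admissible k (drop j a). ?F js)"
      unfolding sum_distrib_left by (intro sum.cong) blast+
    also have "(\<Sum>js\<in>bounded_x_admissible k (drop j a). ?F js) = word_coeff (?g k) (drop j a)"
      by (rule Suc.IH) (use Suc.prems distinct_adj_take_drop set_drop_subset[of j a] in blast)+
    finally have *: "(\<Sum>js\<in>bounded_x_admissible k (drop j a). ?F (replicate j (Suc k) @ js)) =
        (if j = 0 then 1 else 2 * f (Suc k) ^ j) * word_coeff (?g k) (drop j a)" .
    have "word_coeff (gamma n (f (Suc k))) (take j a) =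
        (if peak_set (take j a) = {} then if take j a = [] then 1
          else 2 * f (Suc k) ^ length (take j a) else 0)"
      by (rule word_coeff_gamma)
        (use Suc.prems distinct_adj_take_drop set_take_subset[of j a] in blast)+
    moreover have "take j a = [] \<longleftrightarrow> j = 0" "length (take j a) = j" using j by auto
    ultimately show "(if peak_set (take j a) = {}
        then \<Sum>js\<in>bounded_x_admissible k (drop j a). ?F (replicate j (Suc k) @ js) else 0) =
      word_coeff (gamma n (f (Suc k))) (take j a) * word_coeff (?g k) (drop j a)"
      unfolding * by simp
  qed simp
  also have "\<dots> = word_coeff (gamma n (f (Suc k)) @ ?g k) a" by (rule word_coeff_append[symmetric])
  also have "gamma n (f (Suc k)) @ ?g k = ?g (Suc k)" by (simp add: gblocks_def)
  finally show ?case .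
qed

text \<open>Under a block of entries \<open>i\<close> the letters must strictly decrease and be at
  least \<open>i\<close>, which describes the words of A_i; the step out of the block is strict in
  the indices and imposes no descent.\<close>

lemma z_admissible_block:
  assumes j: "j \<le> length b" and js: "\<And>x. x \<in> set js \<Longrightarrow> i < x" and i: "i \<ge> 1"
  shows "z_admissible b (replicate j i @ js) \<longleftrightarrow>
    (sorted_wrt (>) (take j b) \<and> set (take j b) \<subseteq> {i..}) \<and> z_admissible (drop j b) js"
proof (cases "length js = length b - j")
  case False
  then show ?thesis using j by (auto simp: z_admissible_def)
next
  case len: True
  let ?l = "replicate j i @ js"
  have le: "(\<forall>l<length b. ?l ! l \<le> b ! l) \<longleftrightarrow>
      set (take j b) \<subseteq> {i..} \<and> (\<forall>l<length (drop j b). js ! l \<le> drop j b ! l)" (is "?L \<longleftrightarrow> ?R1 \<and> ?R2")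
  proof (intro iffI conjI)
    assume L: ?L
    show ?R1
    proof
      fix x assume "x \<in> set (take j b)"
      then obtain l where "l < j" "x = b ! l" by (auto simp: in_set_conv_nth)
      then show "x \<in> {i..}" using L[rule_format, of l] j by (auto simp: nth_append)
    qed
    show ?R2
    proof (intro allI impI)
      fix l assume "l < length (drop j b)"
      then show "js ! l \<le> drop j b ! l" using L[rule_format, of "j + l"] j by (auto simp: nth_append)
    qed
  next
    assume R: "?R1 \<and> ?R2"
    show ?L
    proof (intro allI impI)
      fix l assume l: "l < length b"
      show "?l ! l \<le> b ! l"
      proof (cases "l < j")
        case True
        then have "b ! l \<in> set (take j b)" using l by (auto simp: in_set_conv_nth)
        then show ?thesis using True R by (auto simp: nth_append)
      next
        case False
        then show ?thesis using R[THEN conjunct2, rule_format, of "l - j"] l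
          by (auto simp: nth_append)
      qed
    qed
  qed
  have des: "(\<forall>l. l + 1 < length b \<and> ?l ! l = ?l ! (l + 1) \<longrightarrow> b ! l > b ! (l + 1)) \<longleftrightarrow>
      sorted_wrt (>) (take j b) \<and> (\<forall>l. l + 1 < length (drop j b) \<and> js ! l = js ! (l + 1) \<longrightarrow>
        drop j b ! l > drop j b ! (l + 1))" (is "?L \<longleftrightarrow> ?R1 \<and> ?R2")
  proof (intro iffI conjI)
    assume L: ?L
    show ?R1
      using L j by (subst sorted_wrt_iff_nth_Suc_transp) (auto simp: nth_append transp_def)
    show ?R2
    proof (intro allI impI)
      fix l assume "l + 1 < length (drop j b) \<and> js ! l = js ! (l + 1)"
      then show "drop j b ! l > drop j b ! (l + 1)"
        using L[rule_format, of "j + l"] j by (auto simp: nth_append)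
    qed
  next
    assume R: "?R1 \<and> ?R2"
    show ?L
    proof (intro allI impI)
      fix l assume l: "l + 1 < length b \<and> ?l ! l = ?l ! (l + 1)"
      consider "l + 1 < j" | "l + 1 = j" | "l \<ge> j" by linarith
      then show "b ! l > b ! (l + 1)"
      proof cases
        case 1
        then have "take j b ! l > take j b ! (l + 1)"
          using R l by (intro sorted_wrt_nth_less[of "(>)" "take j b"]) auto
        then show ?thesis using 1 by simp
      next
        case 2
        then have "?l ! (l + 1) = js ! 0" "?l ! l = i" by (auto simp: nth_append)
        moreover have "i < js ! 0" using 2 l len by (intro js nth_mem) auto
        ultimately show ?thesis using l by auto
      next
        case 3
        then show ?thesis using R[THEN conjunct2, rule_format, of "l - j"] l
          by (auto simp: nth_append Suc_diff_le)
      qed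
    qed
  qed
  have "sorted_wrt (\<le>) ?l \<longleftrightarrow> sorted_wrt (\<le>) js"
    using js by (auto simp: sorted_wrt_append sorted_wrt_replicate less_imp_le)
  then show ?thesis unfolding z_admissible_def le des using len j i by auto
qed

lemma bounded_z_admissible_step:
  assumes "i \<ge> 1"
  shows "bounded_z_admissible i b = {replicate j i @ js | j js.
    j \<le> length b \<and> (sorted_wrt (>) (take j b) \<and> set (take j b) \<subseteq> {i..}) \<and>
    js \<in> bounded_z_admissible (Suc i) (drop j b)}"
proof (intro set_eqI iffI)
  fix l assume l: "l \<in> bounded_z_admissible i b"
  then have "sorted_wrt (\<le>) l" "\<And>x. x \<in> set l \<Longrightarrow> x \<le> i \<Longrightarrow> x = i"
    by (auto simp: bounded_z_admissible_def z_admissible_def le_antisym)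
  then obtain j js where js: "l = replicate j i @ js" "i \<notin> set js"
    using split_leading_block[of "(\<le>)" l i] by blast
  have gt: "i < x" if "x \<in> set js" for x
    using that js l by (auto simp: bounded_z_admissible_def le_less)
  have "j \<le> length b" using l js by (auto simp: bounded_z_admissible_def z_admissible_def)
  then show "l \<in> {replicate j i @ js | j js.
      j \<le> length b \<and> (sorted_wrt (>) (take j b) \<and> set (take j b) \<subseteq> {i..}) \<and>
      js \<in> bounded_z_admissible (Suc i) (drop j b)}"
    using l gt z_admissible_block[OF _ gt assms, of j b] js(1)
    unfolding bounded_z_admissible_def by (auto simp: Suc_le_eq)
next
  fix l assume "l \<in> {replicate j i @ js | j js.
      j \<le> length b \<and> (sorted_wrt (>) (take j b) \<and> set (take j b) \<subseteq> {i..}) \<and>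
      js \<in> bounded_z_admissible (Suc i) (drop j b)}"
  then obtain j js where l: "l = replicate j i @ js" "j \<le> length b"
    "sorted_wrt (>) (take j b) \<and> set (take j b) \<subseteq> {i..}"
    "js \<in> bounded_z_admissible (Suc i) (drop j b)" by blast
  then show "l \<in> bounded_z_admissible i b"
    using z_admissible_block[OF l(2) _ assms, of js]
    by (auto simp: bounded_z_admissible_def Suc_le_eq less_imp_le)
qed

text \<open>Induction over the rows from \<open>i\<close> on, splitting off the entries equal to
  \<open>i\<close>. When \<open>i >= n\<close>, entries at least \<open>i\<close> cannot stay below
  letters less than \<open>n\<close>, so only the empty word is left.\<close>

lemma sum_bounded_z_admissible:
  assumes "set b \<subseteq> {..<n}" "i \<ge> 1"
  shows "(\<Sum>js\<in>bounded_z_admissible i b. \<Prod>j\<leftarrow>js. f j :: 'a::comm_ring_1) =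
    word_coeff (rows n i f) b"
  using assms
proof (induction "n - i" arbitrary: i b)
  case 0
  have "bounded_z_admissible i b = (if b = [] then {[]} else {})"
  proof (cases b)
    case Nil
    then show ?thesis by (auto simp: bounded_z_admissible_def z_admissible_def)
  next
    case (Cons c d)
    have False if js: "js \<in> bounded_z_admissible i b" for js
    proof -
      have "js ! 0 \<in> set js" "js ! 0 \<le> c"
        using js Cons by (auto simp: bounded_z_admissible_def z_admissible_def)
      then have "i \<le> c" using js by (auto simp: bounded_z_admissible_def)
      then show False using 0 Cons by auto
    qed
    then show ?thesis using Cons by auto
  qed
  then show ?case using 0 by (simp add: rows_empty)
next
  case (Suc m)
  let ?F = "\<lambda>js. \<Prod>j\<leftarrow>js. f j"
  have K: "i \<notin> set js" if "js \<in> bounded_z_admissible (Suc i) b" for js b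
    using that by (auto simp: bounded_z_admissible_def)
  have "(\<Sum>js\<in>bounded_z_admissible i b. ?F js) = (\<Sum>j\<le>length b.
      if sorted_wrt (>) (take j b) \<and> set (take j b) \<subseteq> {i..}
      then \<Sum>js\<in>bounded_z_admissible (Suc i) (drop j b). ?F (replicate j i @ js) else 0)"
    by (rule sum_leading_block[OF K finite_bounded_z_admissible
          bounded_z_admissible_step[OF Suc.prems(2)]])
  also have "\<dots> = (\<Sum>j\<le>length b. word_coeff (down n i (f i)) (take j b) *
      word_coeff (rows n (Suc i) f) (drop j b))"
  proof (rule sum.cong)
    fix j assume "j \<in> {..length b}"
    then have j: "length (take j b) = j" by simp
    have "(\<Sum>js\<in>bounded_z_admissible (Suc i) (drop j b). ?F js) =
        word_coeff (rows n (Suc i) f) (drop j b)"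
      by (rule Suc.hyps(1)) (use Suc set_drop_subset[of j b] in auto)
    moreover have "set (take j b) \<subseteq> {i..<n} \<longleftrightarrow> set (take j b) \<subseteq> {i..}"
      using set_take_subset[of j b] Suc.prems(1) by (auto simp: subset_iff)
    ultimately show "(if sorted_wrt (>) (take j b) \<and> set (take j b) \<subseteq> {i..}
        then \<Sum>js\<in>bounded_z_admissible (Suc i) (drop j b). ?F (replicate j i @ js) else 0) =
      word_coeff (down n i (f i)) (take j b) * word_coeff (rows n (Suc i) f) (drop j b)"
      unfolding word_coeff_down j by (simp add: sum_distrib_left[symmetric])
  qed simp
  also have "\<dots> = word_coeff (rows n i f) b"
    using Suc.hyps(2) by (simp add: rows_unfold[of i n] word_coeff_append)
  finally show ?case .
qed

section \<open>From admissible sequences to monomials\<close>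

lemma sum_A_x:
  assumes "a \<in> reduced_words u" "u \<in> BC n"
  shows "(\<Sum>\<alpha>\<in>{\<alpha> \<in> A_x a. \<forall>i>k. Poly_Mapping.lookup \<alpha> i = 0}.
      2 ^ card (Poly_Mapping.keys \<alpha>) * x_monom \<alpha>) =
    word_coeff (gblocks n (map (\<lambda>m. Var (X m)) (rev [1..<k + 1]))) a"
    and "finite {\<alpha> \<in> A_x a. \<forall>i>k. Poly_Mapping.lookup \<alpha> i = 0}"
proof -
  have A: "{\<alpha> \<in> A_x a. \<forall>i>k. Poly_Mapping.lookup \<alpha> i = 0} = exponent ` bounded_x_admissible k a"
    by (force simp: A_x_def bounded_x_admissible_def lookup_exponent count_list_0_iff
        not_le[symmetric])
  have "inj_on exponent (bounded_x_admissible k a)"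
  proof (rule inj_onI)
    fix js js' assume "js \<in> bounded_x_admissible k a" "js' \<in> bounded_x_admissible k a"
      and e: "exponent js = exponent js'"
    \<comment> \<open>x-admissible sequences decrease weakly, so they are reversed before
      \<open>exponent_inj\<close> is applied.\<close>
    then have s: "sorted (rev js)" "sorted (rev js')"
      by (auto simp: bounded_x_admissible_def x_admissible_def sorted_wrt_rev)
    have "exponent (rev js) = exponent (rev js')"
      by (rule poly_mapping_eqI) (metis e lookup_exponent count_list_rev)
    then show "js = js'" using exponent_inj[OF s] by simp
  qed
  moreover have "distinct_adj a"
    using reduced_words_adjacent[OF assms(1)] by (auto simp: distinct_adj_conv_nth)
  ultimately show "(\<Sum>\<alpha>\<in>{\<alpha> \<in> A_x a. \<forall>i>k. Poly_Mapping.lookup \<alpha> i = 0}.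
      2 ^ card (Poly_Mapping.keys \<alpha>) * x_monom \<alpha>) =
    word_coeff (gblocks n (map (\<lambda>m. Var (X m)) (rev [1..<k + 1]))) a"
    unfolding A using sum_bounded_x_admissible[of a n "\<lambda>m. Var (X m)" k] reduced_words_BC_letters[OF assms]
    by (simp add: sum.reindex x_monom_def prod_exponent keys_exponent[THEN arg_cong[of _ _ card]] del: upt_Suc)
  show "finite {\<alpha> \<in> A_x a. \<forall>i>k. Poly_Mapping.lookup \<alpha> i = 0}"
    unfolding A using finite_bounded_x_admissible by simp
qed

lemma sum_A_z:
  assumes "b \<in> reduced_words v" "v \<in> Sym n"
  shows "(\<Sum>\<beta>\<in>A_z b. z_monom \<beta>) = word_coeff (rows n 1 (\<lambda>i. Var (Z i))) b"
    and "finite (A_z b)"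
proof -
  \<comment> \<open>The lower bound 1 is just the positivity of the indices.\<close>
  have A: "A_z b = exponent ` bounded_z_admissible 1 b"
    by (auto simp: A_z_def bounded_z_admissible_def z_admissible_def)
  show "finite (A_z b)" unfolding A using finite_bounded_z_admissible by simp
  have inj: "inj_on exponent (bounded_z_admissible 1 b)"
    by (rule inj_onI, rule exponent_inj) (auto simp: bounded_z_admissible_def z_admissible_def)
  have "set b \<subseteq> {..<n}" using reduced_words_Sym_letters[OF assms] by auto
  then show "(\<Sum>\<beta>\<in>A_z b. z_monom \<beta>) = word_coeff (rows n 1 (\<lambda>i. Var (Z i))) b"
    unfolding A using inj sum_bounded_z_admissible[of b n 1 "\<lambda>i. Var (Z i)"]
    by (simp add: sum.reindex z_monom_def prod_exponent)
qed

lemma word_coeff_nonzero_letters: "word_coeff L a \<noteq> 0 \<Longrightarrow> set a \<subseteq> fst ` set L"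
proof (induction L a rule: word_coeff.induct)
  case (1 a)
  then show ?case by (simp split: if_splits)
next
  case (2 i t L a)
  show ?case
  proof (cases "word_coeff L a = 0")
    case True
    then obtain b where a: "a = i # b" and "word_coeff L b \<noteq> 0"
      using 2 by (cases a) (auto split: if_splits dest: mult_not_zero)
    then have "set b \<subseteq> fst ` set L" using "2.IH"(2) by simp
    then show ?thesis using a by auto
  qed (use 2 in auto)
qed

lemma word_coeff_rows_Sym:
  assumes "word_coeff (rows n 1 z) b \<noteq> 0" shows "word_prod b \<in> Sym n"
proof -
  have "fst ` set (rows n 1 z) \<subseteq> {1..<n}" by (auto simp: rows_def down_def)
  then have "set b \<subseteq> {1..<n}" using word_coeff_nonzero_letters[OF assms] by blast
  then show ?thesis unfolding Sym_def by blast
qed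

section \<open>Reduced factorizations and the admissible sum\<close>

definition reduced_factorizations :: "nat \<Rightarrow> (int \<Rightarrow> int) \<Rightarrow> ((int \<Rightarrow> int) \<times> (int \<Rightarrow> int)) set" where
  "reduced_factorizations n w = {(u, v). u \<in> BC n \<and> v \<in> Sym n \<and> u \<circ> v = w \<and>
     cox_length u + cox_length v = cox_length w}"

lemma finite_reduced_factorizations: "finite (reduced_factorizations n w)"
  by (rule finite_subset[of _ "BC n \<times> BC n"])
    (auto simp: reduced_factorizations_def finite_BC Sym_subset_BC)

text \<open>A reduced word of \<open>w\<close> is cut into letters from the \<Gamma>-blocks and
  letters from the staircase; both parts are reduced, and their products form a reduced
  factorization.\<close>

lemma nil_coeff_dream_factors_split:
  assumes w: "w \<in> BC n"
  shows "nil_coeff (dream_factors n xs z) w = (\<Sum>(u, v)\<in>reduced_factorizations n w.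
    (\<Sum>a\<in>reduced_words u. word_coeff (gblocks n xs) a) *
    (\<Sum>b\<in>reduced_words v. word_coeff (rows n 1 z) b))"
proof -
  let ?f = "\<lambda>a b. word_coeff (gblocks n xs) a * word_coeff (rows n 1 z) b"
  \<comment> \<open>Four index sets in succession: reduced words with a cut position
    (\<open>?S\<close>), the resulting pairs (\<open>?T\<close>), the pairs whose second product
    lies in \<open>Sym n\<close> (\<open>?T'\<close>), and these grouped by factorization
    (\<open>?U\<close>).\<close>
  let ?S = "SIGMA c:reduced_words w. {..length c}"
  let ?T = "{(a, b). a @ b \<in> reduced_words w}"
  let ?T' = "{(a, b). a @ b \<in> reduced_words w \<and> word_prod b \<in> Sym n}"
  let ?U = "SIGMA uv:reduced_factorizations n w. reduced_words (fst uv) \<times> reduced_words (snd uv)"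
  have fin: "finite (reduced_words w)" by (rule finite_reduced_words[OF w])
  have bij: "bij_betw (\<lambda>(c, j). (take j c, drop j c)) ?S ?T"
    by (rule bij_betw_byWitness[where f' = "\<lambda>(a, b). (a @ b, length a)"]) auto
  then have finT: "finite ?T" using fin bij_betw_finite by fast
  have bij': "bij_betw snd ?U ?T'"
  proof (rule bij_betw_byWitness[where f' = "\<lambda>(a, b). ((word_prod a, word_prod b), (a, b))"])
    show "\<forall>p\<in>?U. (case snd p of (a, b) \<Rightarrow> ((word_prod a, word_prod b), (a, b))) = p"
      by (auto simp: reduced_words_def)
    show "snd ` ?U \<subseteq> ?T'"
      by (auto simp: reduced_factorizations_def reduced_words_def word_prod_append)
    show "(\<lambda>(a, b). ((word_prod a, word_prod b), (a, b))) ` ?T' \<subseteq> ?U"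
    proof
      fix p assume "p \<in> (\<lambda>(a, b). ((word_prod a, word_prod b), (a, b))) ` ?T'"
      then obtain a b where ab: "a @ b \<in> reduced_words w" "word_prod b \<in> Sym n"
        and p: "p = ((word_prod a, word_prod b), (a, b))" by auto
      have "set a \<subseteq> {..<n}" using reduced_words_BC_letters[OF ab(1) w] by simp
      then have "word_prod a \<in> BC n" by (rule word_prod_in_BC)
      moreover have "word_prod a \<circ> word_prod b = w"
        using ab(1) by (simp add: reduced_words_def word_prod_append)
      ultimately show "p \<in> ?U" unfolding p
        using reduced_words_append[OF ab(1)] ab(2) by (simp add: reduced_factorizations_def)
    qed
  qed simp
  have "nil_coeff (dream_factors n xs z) w = (\<Sum>c\<in>reduced_words w. \<Sum>j\<le>length c. ?f (take j c) (drop j c))"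
    unfolding nil_coeff_eq_sum_word_coeff[OF BC_subset_BC_inf[OF w]] dream_factors_def word_coeff_append ..
  also have "\<dots> = (\<Sum>(c, j)\<in>?S. ?f (take j c) (drop j c))"
    using fin by (intro sum.Sigma) auto
  also have "\<dots> = (\<Sum>(a, b)\<in>?T. ?f a b)"
    using sum.reindex_bij_betw[OF bij, of "\<lambda>(a, b). ?f a b"] by (simp add: case_prod_unfold)
  \<comment> \<open>The discarded pairs contribute 0, because the rows supply only letters s_1, ...,
    s_{n-1}.\<close>
  also have "\<dots> = (\<Sum>(a, b)\<in>?T'. ?f a b)"
  proof (rule sum.mono_neutral_right[OF finT])
    show "\<forall>p\<in>?T - ?T'. (case p of (a, b) \<Rightarrow> ?f a b) = 0"
      using word_coeff_rows_Sym[of n z] by (auto dest: mult_not_zero simp del: One_nat_def)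
  qed auto
  also have "\<dots> = (\<Sum>p\<in>?U. ?f (fst (snd p)) (snd (snd p)))"
    using sum.reindex_bij_betw[OF bij', of "\<lambda>(a, b). ?f a b"] by (simp add: case_prod_unfold)
  also have "\<dots> = (\<Sum>uv\<in>reduced_factorizations n w.
      \<Sum>p\<in>reduced_words (fst uv) \<times> reduced_words (snd uv). ?f (fst p) (snd p))"
  proof (subst sum.Sigma)
    show "\<forall>uv\<in>reduced_factorizations n w. finite (reduced_words (fst uv) \<times> reduced_words (snd uv))"
      by (auto simp: reduced_factorizations_def intro!: finite_reduced_words Sym_subset_BC)
  qed (simp_all add: case_prod_unfold finite_reduced_factorizations)
  also have "\<dots> = (\<Sum>(u, v)\<in>reduced_factorizations n w.
    (\<Sum>a\<in>reduced_words u. word_coeff (gblocks n xs) a) *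
    (\<Sum>b\<in>reduced_words v. word_coeff (rows n 1 z) b))"
    by (simp add: sum_product sum.cartesian_product case_prod_unfold)
  finally show ?thesis .
qed

lemma admissible_sum_eq_nil_coeff:
  assumes w: "w \<in> BC n"
  shows "admissible_sum n k w =
    nil_coeff (dream_factors n (map (\<lambda>m. Var (X m)) (rev [1..<k + 1])) (\<lambda>i. Var (Z i))) w"
proof -
  let ?g = "gblocks n (map (\<lambda>m. Var (X m)) (rev [1..<k + 1]))"
  let ?r = "rows n 1 (\<lambda>i. Var (Z i))"
  let ?A = "\<lambda>a. {\<alpha> \<in> A_x a. \<forall>i>k. Poly_Mapping.lookup \<alpha> i = 0}"
  let ?c = "\<lambda>\<alpha>. 2 ^ card (Poly_Mapping.keys \<alpha>) * x_monom \<alpha>"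
  have "(\<Sum>(a, \<alpha>) \<in> {(a, \<alpha>). a \<in> reduced_words u \<and> \<alpha> \<in> A_x a \<and>
        (\<forall>i > k. Poly_Mapping.lookup \<alpha> i = 0)}.
      \<Sum>(b, \<beta>) \<in> {(b, \<beta>). b \<in> reduced_words v \<and> \<beta> \<in> A_z b}.
        2 ^ card (Poly_Mapping.keys \<alpha>) * x_monom \<alpha> * z_monom \<beta>) =
      (\<Sum>a\<in>reduced_words u. word_coeff ?g a) * (\<Sum>b\<in>reduced_words v. word_coeff ?r b)"
    (is "?lhs = _") if uv: "u \<in> BC n" "v \<in> Sym n" for u v
  proof -
    have fu: "finite (reduced_words u)" and fv: "finite (reduced_words v)"
      using uv by (auto intro: finite_reduced_words Sym_subset_BC)
    have sets: "{(a, \<alpha>). a \<in> reduced_words u \<and> \<alpha> \<in> A_x a \<and>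
        (\<forall>i > k. Poly_Mapping.lookup \<alpha> i = 0)} = Sigma (reduced_words u) ?A"
      "{(b, \<beta>). b \<in> reduced_words v \<and> \<beta> \<in> A_z b} = Sigma (reduced_words v) A_z"
      by auto
    \<comment> \<open>The summand is a term in \<open>\<alpha>\<close> times a term in
      \<open>\<beta>\<close>, so the double sum factors.\<close>
    have "?lhs = (\<Sum>(a, \<alpha>)\<in>Sigma (reduced_words u) ?A. ?c \<alpha>) *
        (\<Sum>(b, \<beta>)\<in>Sigma (reduced_words v) A_z. z_monom \<beta>)"
      unfolding sets by (simp add: sum_product case_prod_unfold)
    also have "(\<Sum>(a, \<alpha>)\<in>Sigma (reduced_words u) ?A. ?c \<alpha>) =
        (\<Sum>a\<in>reduced_words u. \<Sum>\<alpha>\<in>?A a. ?c \<alpha>)"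
      by (rule sum.Sigma[symmetric]) (use fu sum_A_x(2)[OF _ uv(1)] in auto)
    also have "\<dots> = (\<Sum>a\<in>reduced_words u. word_coeff ?g a)"
      by (rule sum.cong) (use sum_A_x(1)[OF _ uv(1)] in auto)
    also have "(\<Sum>(b, \<beta>)\<in>Sigma (reduced_words v) A_z. z_monom \<beta>) =
        (\<Sum>b\<in>reduced_words v. \<Sum>\<beta>\<in>A_z b. z_monom \<beta>)"
      by (rule sum.Sigma[symmetric]) (use fv sum_A_z(2)[OF _ uv(2)] in auto)
    also have "\<dots> = (\<Sum>b\<in>reduced_words v. word_coeff ?r b)"
      by (rule sum.cong) (use sum_A_z(1)[OF _ uv(2)] in auto)
    finally show ?thesis .
  qed
  then show ?thesis
    unfolding admissible_sum_def nil_coeff_dream_factors_split[OF w]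
      reduced_factorizations_def[symmetric]
    by (intro sum.cong refl) (auto simp: reduced_factorizations_def)
qed

theorem theorem3p4:
  fixes n k :: nat and w :: "int \<Rightarrow> int"
  assumes "n \<ge> 1" and "w \<in> BC n"
  shows "(\<Sum>D\<in>PD k n w. pd_monom k n D) = admissible_sum n k w \<and>
    (\<forall>C. schubert_C_family C \<longrightarrow> admissible_sum n k w = truncation k (C w))"
proof (intro conjI allI impI)
  \<comment> \<open>All three expressions are the coefficient of u_w in G at x_k, ..., x_1 and z_1,
    z_2, ....\<close>
  show "(\<Sum>D\<in>PD k n w. pd_monom k n D) = admissible_sum n k w"
    by (simp only: sum_PD[OF assms(2)] admissible_sum_eq_nil_coeff[OF assms(2)])
next
  fix C assume "schubert_C_family C"
  then show "admissible_sum n k w = truncation k (C w)"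
    using assms by (simp only: truncation_eq_eval_at eval_at_schubert_C
        admissible_sum_eq_nil_coeff less_eq_Suc_le One_nat_def)
qed


end
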